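(* Let $m \ge 1$ be an integer. (1) For $n = 4m$, the frame set $\mathscr{F}(h_n)$ is not equal to $\{(\alpha,\beta)\in\mathbb{R}_{>0}^2 : \alpha\beta<1\}$. (2) For $n = 4m+1$, the frame set $\mathscr{F}(h_n)$ is not equal to $\{(\alpha,\beta)\in\mathbb{R}_{>0}^2 : \alpha\beta<1 \text{ and } \alpha\beta \neq \tfrac{q-1}{q} \text{ for all integers } q\ge 2\}$. That is, the frame set conjecture for Hermite functions is false for all orders $n=4m$ and $n=4m+1$ with $m\ge 1$.
   Context: For $n\in\mathbb{Z}_{\ge 0}$ the Hermite function is $h_n(x) = (-1)^n c_n^{-1/2} e^{\pi x^2}\frac{d^n}{dx^n}e^{-2\pi x^2}$, $x \in \mathbb{R}$, with $c_n=(2\pi)^n 2^{n-1/2} n!$. For $g\in L^2(\mathbb{R})$ and $\alpha,\beta>0$, the Gabor system is $\mathcal{G}(g,\alpha,\beta)=\{e^{2\pi i\beta m\cdot}g(\cdot-\alpha k)\}_{k,m\in\mathbb{Z}}$. It is a frame for $L^2(\mathbb{R})$ if there are constants $A,B>0$ with $A\|f\|^2\le\sum_{k,m\in\mathbb{Z}}|\langle f,e^{2\pi i\beta m\cdot}g(\cdot-\alpha k)\rangle|^2\le B\|f\|^2$ for all $f\in L^2(\mathbb{R})$. The frame set $\mathscr{F}(g)$ is the set of $(\alpha,\beta)\in\mathbb{R}_{>0}^2$ for which $\mathcal{G}(g,\alpha,\beta)$ is a frame for $L^2(\mathbb{R})$. The frame set conjecture for Hermite functions asserts that $\mathscr{F}(h_n)=\{\alpha\beta<1\}$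 for $n$ even and $\mathscr{F}(h_n)=\{\alpha\beta<1,\ \alpha\beta\ne \tfrac12,\tfrac23,\dots\}$ for $n$ odd. *)

theory Defs
  imports "HOL-Analysis.Analysis"
begin

definition hermite_const :: "nat \<Rightarrow> real" where
  "hermite_const n = (2 * pi) ^ n * 2 powr (real n - 1 / 2) * fact n"

definition hermite_function :: "nat \<Rightarrow> real \<Rightarrow> real" where
  "hermite_function n x =
     (-1) ^ n * hermite_const n powr (- 1 / 2) * exp (pi * x\<^sup>2) *
     (deriv ^^ n) (\<lambda>t. exp (- 2 * pi * t\<^sup>2)) x"

(* Elements of L^2(R) are represented by square-integrable Borel functions; every
   a.e.-class of Lebesgue measurable functions contains a Borel representative, and
   the quantities below only depend on the class. *)
definition L2 :: "(real \<Rightarrow> complex) set" where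
  "L2 = {f \<in> borel_measurable lborel. integrable lborel (\<lambda>x. (cmod (f x))\<^sup>2)}"

definition L2_inner :: "(real \<Rightarrow> complex) \<Rightarrow> (real \<Rightarrow> complex) \<Rightarrow> complex" where
  "L2_inner f g = (LINT x|lborel. f x * cnj (g x))"

definition L2_norm :: "(real \<Rightarrow> complex) \<Rightarrow> real" where
  "L2_norm f = sqrt (LINT x|lborel. (cmod (f x))\<^sup>2)"

(* Indexed families of elements of L^2(R), so repetitions count. Summability is part of the
   upper bound: infsum is 0 for a family that is not summable. *)
definition L2_frame :: "('i \<Rightarrow> real \<Rightarrow> complex) \<Rightarrow> bool" where
  "L2_frame \<phi> \<longleftrightarrow>
     (\<exists>A>0. \<exists>B>0. \<forall>f\<in>L2.
        (\<lambda>i. (cmod (L2_inner f (\<phi> i)))\<^sup>2) summable_on UNIV \<and>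
        A * (L2_norm f)\<^sup>2 \<le> (\<Sum>\<^sub>\<infinity>i. (cmod (L2_inner f (\<phi> i)))\<^sup>2) \<and>
        (\<Sum>\<^sub>\<infinity>i. (cmod (L2_inner f (\<phi> i)))\<^sup>2) \<le> B * (L2_norm f)\<^sup>2)"

definition gabor_system ::
  "(real \<Rightarrow> complex) \<Rightarrow> real \<Rightarrow> real \<Rightarrow> int \<times> int \<Rightarrow> real \<Rightarrow> complex" where
  "gabor_system g \<alpha> \<beta> = (\<lambda>(k, m) x.
     exp (2 * complex_of_real pi * \<i> * of_real \<beta> * of_int m * of_real x) *
     g (x - \<alpha> * of_int k))"

(* Meant for windows g in L^2(R). *)
definition frame_set :: "(real \<Rightarrow> complex) \<Rightarrow> (real \<times> real) set" where
  "frame_set g = {(\<alpha>, \<beta>). \<alpha> > 0 \<and> \<beta> > 0 \<and> L2_frame (gabor_system g \<alpha> \<beta>)}"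

end

theory Submission
  imports Defs
begin

text \<open>
  For each order a point \<open>(\<alpha>, \<beta>)\<close> is produced at which the Gabor system is not a frame although the
  conjecture predicts one: with \<open>\<alpha> * \<beta> = 1 / 3\<close> for \<open>n = 4 * m\<close>, and \<open>\<alpha> * \<beta> = 1 / 4\<close> for
  \<open>n = 4 * m + 1\<close>.

  At \<open>\<alpha> * \<beta> = 1 / q\<close> the frame property fails as soon as the \<open>q\<close> values of the Zak transform that belong
  to one point, the sums of \<open>c l * g (\<xi> + \<alpha> * (q * l - k))\<close> over \<open>l\<close>, vanish for all \<open>k\<close>
  (\<open>not_frame_if_shifted_sums_vanish\<close>). A comb of \<open>L\<close> narrow bumps with coefficients \<open>c\<close> and spacing
  \<open>1 / \<beta>\<close> then has frame coefficients that come only from the two ends of the comb, whereas its norm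
  squared is proportional to \<open>L\<close>.

  For Hermite functions the parity of \<open>h\<^sub>n\<close> makes most of these sums vanish or coincide up to sign. What
  remains is a single equation: \<open>h\<^sub>n(a) - h\<^sub>n(3 a) + h\<^sub>n(5 a) - ... = 0\<close> for odd \<open>n\<close> with \<open>q = 4\<close> and \<open>\<alpha> = a\<close>,
  and \<open>h\<^sub>n(a) - h\<^sub>n(5 a) - h\<^sub>n(7 a) + h\<^sub>n(11 a) + ... = 0\<close> for even \<open>n\<close> with \<open>q = 3\<close> and \<open>\<alpha> = 2 a\<close>
  (\<open>all_odd_lacunary_sums_vanish\<close>, \<open>all_even_lacunary_sums_vanish\<close>). It has a solution because the left
  side changes sign. For large \<open>a\<close> the first term dominates and is positive. On the other hand \<open>h\<^sub>n\<close> is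
  positive and decreasing beyond its turning point \<open>T\<close> (\<open>hermite_decreasing_beyond_turning_point\<close>), so
  that for \<open>3 a \<ge> T\<close> the terms after the first contribute at most 0; and for \<open>n \<ge> 3\<close> there is such an
  \<open>a\<close> with \<open>h\<^sub>n(a) < 0\<close>, by a Sturm comparison (\<open>hermite_poly_negative_beyond\<close>).
\<close>

section \<open>Exponentially decaying families indexed by the integers\<close>

lemma geometric_exp_has_sum:
  fixes a K :: real and p :: int
  assumes "a > 0"
  shows "((\<lambda>l. K * exp (- a * of_int (l - p))) has_sum (K / (1 - exp (- a)))) {p..}"
proof -
  have "(\<lambda>n. exp (- a) ^ n) sums (1 / (1 - exp (- a)))"
    by (rule geometric_sums) (use assms in simp)
  hence "((\<lambda>n. exp (- a) ^ n) has_sum (1 / (1 - exp (- a)))) (UNIV :: nat set)"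
    by (rule sums_nonneg_imp_has_sum) simp
  hence "((\<lambda>n. K * exp (- a) ^ n) has_sum (K * (1 / (1 - exp (- a))))) (UNIV :: nat set)"
    by (rule has_sum_cmult_right)
  also have "((\<lambda>n. K * exp (- a) ^ n) has_sum (K * (1 / (1 - exp (- a))))) (UNIV :: nat set)
      \<longleftrightarrow> ((\<lambda>l. K * exp (- a * of_int (l - p))) has_sum (K / (1 - exp (- a)))) {p..}"
    by (rule has_sum_reindex_bij_witness[of _ "\<lambda>l. nat (l - p)" "\<lambda>n. p + int n"])
       (auto simp: exp_of_nat_mult[symmetric] mult_ac)
  finally show ?thesis .
qed

lemma right_tail_bound:
  fixes f :: "int \<Rightarrow> real" and p :: int
  assumes a: "a > 0" and sp: "s \<le> a * of_int p"
    and f: "\<And>l. \<bar>f l\<bar> \<le> C * exp (- \<bar>a * of_int l - s\<bar>)"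
  shows "f summable_on {p..}"
    and "\<bar>infsum f {p..}\<bar> \<le> C / (1 - exp (- a)) * exp (- \<bar>a * of_int p - s\<bar>)"
proof -
  define g where "g = (\<lambda>l. (C * exp (- (a * of_int p - s))) * exp (- a * of_int (l - p)))"
  have g: "(g has_sum (C * exp (- (a * of_int p - s))) / (1 - exp (- a))) {p..}"
    unfolding g_def by (rule geometric_exp_has_sum[OF a])
  have le: "norm (f l) \<le> g l" if "l \<in> {p..}" for l
  proof -
    have "a * of_int p \<le> a * of_int l"
      using a that by simp
    hence "\<bar>a * of_int l - s\<bar> = (a * of_int p - s) + a * of_int (l - p)"
      using sp by (simp add: algebra_simps)
    hence "exp (- \<bar>a * of_int l - s\<bar>) = exp (- (a * of_int p - s)) * exp (- a * of_int (l - p))"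
      by (simp add: mult_exp_exp algebra_simps)
    thus ?thesis using f[of l] by (simp add: g_def mult_ac)
  qed
  show fs: "f summable_on {p..}"
    using Infinite_Sum.abs_summable_on_comparison_test'[OF has_sum_imp_summable[OF g] le]
    by (rule abs_summable_summable)
  have "norm (infsum f {p..}) \<le> C * exp (- (a * of_int p - s)) / (1 - exp (- a))"
    by (rule norm_infsum_le[OF has_sum_infsum[OF fs] g le])
  thus "\<bar>infsum f {p..}\<bar> \<le> C / (1 - exp (- a)) * exp (- \<bar>a * of_int p - s\<bar>)"
    using sp by (simp add: mult_ac)
qed

lemma left_tail_bound:
  fixes f :: "int \<Rightarrow> real" and p :: int
  assumes a: "a > 0" and sp: "a * of_int p \<le> s"
    and f: "\<And>l. \<bar>f l\<bar> \<le> C * exp (- \<bar>a * of_int l - s\<bar>)"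
  shows "f summable_on {..<p}"
    and "\<bar>infsum f {..<p}\<bar> \<le> C / (1 - exp (- a)) * exp (- \<bar>a * of_int p - s\<bar>)"
proof -
  have C: "C \<ge> 0"
    using f[of 0] by (smt (verit) exp_gt_zero mult_less_0_iff)
  have f': "\<bar>f (- l)\<bar> \<le> C * exp (- \<bar>a * of_int l - (- s)\<bar>)" for l
    using f[of "- l"] by (simp add: abs_minus_commute algebra_simps)
  have sp': "- s \<le> a * of_int (1 - p)"
    using a sp by (simp add: algebra_simps)
  note R = right_tail_bound[of a "- s" "1 - p" "\<lambda>l. f (- l)", OF a sp' f']
  have eq: "((\<lambda>l. f (- l)) has_sum S) {1 - p..} \<longleftrightarrow> (f has_sum S) {..<p}" for S
    by (rule has_sum_reindex_bij_witness[of _ "uminus" "uminus"]) auto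
  have hs: "(f has_sum infsum (\<lambda>l. f (- l)) {1 - p..}) {..<p}"
    using eq has_sum_infsum[OF R(1)] by blast
  thus "f summable_on {..<p}" by (rule has_sum_imp_summable)
  have "infsum f {..<p} = infsum (\<lambda>l. f (- l)) {1 - p..}"
    using hs by (rule infsumI)
  hence "\<bar>infsum f {..<p}\<bar> \<le> C / (1 - exp (- a)) * exp (- \<bar>a * of_int (1 - p) - (- s)\<bar>)"
    using R(2) by simp
  also have "\<dots> \<le> C / (1 - exp (- a)) * exp (- \<bar>a * of_int p - s\<bar>)"
    by (intro mult_left_mono) (use C a sp in \<open>auto simp: algebra_simps\<close>)
  finally show "\<bar>infsum f {..<p}\<bar> \<le> C / (1 - exp (- a)) * exp (- \<bar>a * of_int p - s\<bar>)" .
qed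

lemma exp_decay_summable:
  fixes f :: "int \<Rightarrow> real"
  assumes a: "a > 0"
    and f: "\<And>l. \<bar>f l\<bar> \<le> C * exp (- \<bar>a * of_int l - s\<bar>)"
  shows "f summable_on A"
proof -
  define p where "p = \<lceil>s / a\<rceil>"
  define f' where "f' = (\<lambda>l::int. C * exp (- \<bar>a * of_int l - s\<bar>))"
  have C: "C \<ge> 0"
    using f[of 0] by (smt (verit) exp_gt_zero mult_less_0_iff)
  have p: "s \<le> a * of_int p"
    using a unfolding p_def by (metis divide_le_eq le_of_int_ceiling mult.commute)
  have p': "a * of_int (p - 1) \<le> s"
  proof -
    have "of_int p < s / a + 1" unfolding p_def by linarith
    hence "a * of_int p < a * (s / a + 1)" using a by simp
    thus ?thesis using a by (simp add: algebra_simps)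
  qed
  have f'': "\<bar>f' l\<bar> \<le> C * exp (- \<bar>a * of_int l - s\<bar>)" for l
    using C by (simp add: f'_def)
  have "f' summable_on {p..}" by (rule right_tail_bound[OF a p f''])
  moreover have "f' summable_on {..<p - 1}" by (rule left_tail_bound[OF a p' f''])
  ultimately have "f' summable_on ({..<p - 1} \<union> {p - 1}) \<union> {p..}"
    by (intro summable_on_Un_disjoint) auto
  also have "({..<p - 1} \<union> {p - 1}) \<union> {p..} = (UNIV :: int set)" by auto
  finally have "f' summable_on A" by (rule summable_on_subset) simp
  hence "(\<lambda>l. norm (f l)) summable_on A"
    by (rule Infinite_Sum.abs_summable_on_comparison_test') (use f in \<open>auto simp: f'_def\<close>)
  thus ?thesis by (rule abs_summable_summable)
qed

text \<open>The point is that the tail is small even when \<^term>\<open>p\<close> lies to the left of the peak of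
  \<^term>\<open>f\<close>: since the total is zero, the right tail is minus the left tail, and one of the two
  does not contain the peak.\<close>
lemma null_sum_tail_bound:
  fixes f :: "int \<Rightarrow> real" and p :: int
  assumes a: "a > 0" and f: "\<And>l. \<bar>f l\<bar> \<le> C * exp (- \<bar>a * of_int l - s\<bar>)"
    and zero: "(f has_sum 0) UNIV"
  shows "\<bar>infsum f {p..}\<bar> \<le> C / (1 - exp (- a)) * exp (- \<bar>a * of_int p - s\<bar>)"
proof (cases "s \<le> a * of_int p")
  case True
  thus ?thesis by (rule right_tail_bound[OF a _ f])
next
  case False
  have "(f has_sum (infsum f {..<p} + infsum f {p..})) ({..<p} \<union> {p..})"
    by (intro has_sum_Un_disjoint has_sum_infsum exp_decay_summable[OF a f]) auto
  also have "{..<p} \<union> {p..} = UNIV" by auto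
  finally have "infsum f {p..} = - infsum f {..<p}"
    using zero by (auto dest!: infsumI)
  thus ?thesis using left_tail_bound(2)[OF a _ f, of p] False by simp
qed

text \<open>A block of a family with sum zero is a difference of two tails, so it only feels the distance
  of the peak \<^term>\<open>s\<close> to the two ends of the block. The length of the block does not enter.\<close>
lemma null_sum_block_bound:
  fixes f :: "int \<Rightarrow> real"
  assumes a: "a > 0" and f: "\<And>l. \<bar>f l\<bar> \<le> C * exp (- \<bar>a * of_int l - s\<bar>)"
    and zero: "(f has_sum 0) UNIV" and L: "L \<ge> 0"
  shows "(\<Sum>l=0..<L. f l)\<^sup>2 \<le> 2 * (C / (1 - exp (- a)))\<^sup>2 *
           (exp (- 2 * \<bar>s\<bar>) + exp (- 2 * \<bar>s - a * of_int L\<bar>))"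
proof -
  define K where "K = C / (1 - exp (- a))"
  have "(f has_sum ((\<Sum>l=0..<L. f l) + infsum f {L..})) ({0..<L} \<union> {L..})"
    by (intro has_sum_Un_disjoint has_sum_infsum exp_decay_summable[OF a f] has_sum_finite) auto
  also have "{0..<L} \<union> {L..} = {0..}" using L by auto
  finally have "(\<Sum>l=0..<L. f l) = infsum f {0..} - infsum f {L..}"
    by (auto dest!: infsumI)
  moreover have "\<bar>infsum f {0..}\<bar> \<le> K * exp (- \<bar>s\<bar>)"
    using null_sum_tail_bound[OF a f zero, of 0] by (simp add: K_def)
  moreover have "\<bar>infsum f {L..}\<bar> \<le> K * exp (- \<bar>s - a * of_int L\<bar>)"
    using null_sum_tail_bound[OF a f zero, of L] by (simp add: K_def abs_minus_commute)
  ultimately have "\<bar>\<Sum>l=0..<L. f l\<bar> \<le> K * exp (- \<bar>s\<bar>) + K * exp (- \<bar>s - a * of_int L\<bar>)"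
    by linarith
  hence "(\<Sum>l=0..<L. f l)\<^sup>2 \<le> (K * exp (- \<bar>s\<bar>) + K * exp (- \<bar>s - a * of_int L\<bar>))\<^sup>2"
    by (rule abs_le_square_iff[THEN iffD1, OF order_trans]) simp
  also have "\<dots> \<le> 2 * ((K * exp (- \<bar>s\<bar>))\<^sup>2 + (K * exp (- \<bar>s - a * of_int L\<bar>))\<^sup>2)"
    using sum_squares_bound[of "K * exp (- \<bar>s\<bar>)" "K * exp (- \<bar>s - a * of_int L\<bar>)"]
    by (simp add: power2_sum)
  also have "\<dots> = 2 * K\<^sup>2 * (exp (- 2 * \<bar>s\<bar>) + exp (- 2 * \<bar>s - a * of_int L\<bar>))"
    by (simp add: power_mult_distrib exp_double[symmetric] algebra_simps)
  finally show ?thesis by (simp add: K_def)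
qed

lemma continuous_on_infsum_M_test:
  fixes f :: "'i \<Rightarrow> real \<Rightarrow> real"
  assumes "\<And>i x. x \<in> S \<Longrightarrow> \<bar>f i x\<bar> \<le> M i" "M summable_on UNIV" "\<And>i. continuous_on S (f i)"
  shows "continuous_on S (\<lambda>x. \<Sum>\<^sub>\<infinity>i. f i x)"
  by (rule uniform_limit_theorem[OF _ Weierstrass_m_test_general[of UNIV S f M]])
     (use assms in \<open>auto intro!: always_eventually continuous_intros\<close>)

section \<open>Bessel's inequality\<close>

lemma integral_character_period:
  fixes b :: real and j :: int
  assumes b: "b > 0"
  shows "(LINT t|lborel. indicator {0..b} t *\<^sub>R exp (2 * complex_of_real pi * \<i> * of_int j * of_real t / of_real b))
           = (if j = 0 then of_real b else 0)"
proof (cases "j = 0")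
  case True
  thus ?thesis using b by (simp add: scaleR_conv_of_real)
next
  case False
  define w where "w = 2 * complex_of_real pi * \<i> * of_int j / of_real b"
  have w: "w \<noteq> 0" using False b by (simp add: w_def)
  have "((\<lambda>t. exp (w * of_real t) / w) has_vector_derivative exp (w * of_real t)) (at t within A)" for t A
  proof -
    have "((\<lambda>z. exp (w * z) / w) has_field_derivative exp (w * of_real t)) (at (of_real t))"
      by (rule derivative_eq_intros refl | use w in simp)+
    from has_vector_derivative_real_field[OF this]
    show ?thesis by (simp add: o_def)
  qed
  hence "(LINT t|lborel. indicator {0..b} t *\<^sub>R exp (w * of_real t)) = exp (w * of_real b) / w - exp (w * of_real 0) / w"
    using b by (intro integral_FTC_Icc continuous_intros) auto
  also have "w * of_real b = 2 * of_int j * of_real pi * \<i>"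
    using b by (simp add: w_def)
  also have "exp \<dots> = 1"
    using exp_integer_2pi[of "of_int j"] by (simp add: mult_ac)
  finally show ?thesis using False by (simp add: w_def algebra_simps)
qed

text \<open>The proof expands the nonnegative integral of \<open>|\<Phi> - P|\<^sup>2\<close>, where \<open>P\<close> is the orthogonal projection of
  \<open>\<Phi>\<close> to the span of the \<open>e i\<close>; the common squared norm of the \<open>e i\<close> is \<open>b\<close>.\<close>
lemma bessel_inequality:
  fixes \<Phi> :: "'a \<Rightarrow> complex" and e :: "'i \<Rightarrow> 'a \<Rightarrow> complex"
  assumes "finite_measure N"
    and \<Phi>: "\<Phi> \<in> borel_measurable N" "\<And>t. cmod (\<Phi> t) \<le> D"
    and e: "\<And>i. e i \<in> borel_measurable N" "\<And>i t. cmod (e i t) \<le> 1"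
    and orth: "\<And>i j. (LINT t|N. e i t * cnj (e j t)) = (if i = j then of_real b else 0)"
    and b: "b > 0" and I: "finite I"
  shows "(\<Sum>i\<in>I. (cmod (LINT t|N. \<Phi> t * cnj (e i t)))\<^sup>2) \<le> b * (LINT t|N. (cmod (\<Phi> t))\<^sup>2)"
proof -
  interpret finite_measure N by fact
  have D: "D \<ge> 0" using \<Phi>(2) norm_ge_zero order_trans by blast
  have cm: "(\<lambda>t. cnj (f t)) \<in> borel_measurable N" if "f \<in> borel_measurable N" for f
    using that by (intro borel_measurable_continuous_on[where f = cnj]) (auto intro: continuous_intros)
  note [measurable] = \<Phi>(1) e(1) cm[OF \<Phi>(1)] cm[OF e(1)]
  have int1: "integrable N (\<lambda>t. \<Phi> t * cnj (e i t))" for i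
  proof (rule integrable_const_bound[where B = D])
    show "AE t in N. cmod (\<Phi> t * cnj (e i t)) \<le> D"
    proof (rule AE_I2)
      fix t
      have "cmod (\<Phi> t) * cmod (e i t) \<le> D * 1"
        by (intro mult_mono \<Phi>(2) e(2) D) simp
      thus "cmod (\<Phi> t * cnj (e i t)) \<le> D" by (simp add: norm_mult)
    qed
  qed measurable
  have int2: "integrable N (\<lambda>t. e i t * cnj (e j t))" for i j
  proof (rule integrable_const_bound[where B = 1])
    show "AE t in N. cmod (e i t * cnj (e j t)) \<le> 1"
      using e(2) by (auto simp: norm_mult intro!: AE_I2 mult_le_one)
  qed measurable
  have int0: "integrable N (\<lambda>t. \<Phi> t * cnj (\<Phi> t))"
  proof (rule integrable_const_bound[where B = "D * D"])
    show "AE t in N. cmod (\<Phi> t * cnj (\<Phi> t)) \<le> D * D"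
      using \<Phi>(2) D by (auto simp: norm_mult intro!: AE_I2 mult_mono)
  qed measurable
  define a where "a = (\<lambda>i. LINT t|N. \<Phi> t * cnj (e i t))"
  define P where "P = (\<lambda>t. \<Sum>i\<in>I. a i * e i t)"
  define s where "s = (\<Sum>i\<in>I. (cmod (a i))\<^sup>2)"
  have s: "of_real s = (\<Sum>i\<in>I. a i * cnj (a i))"
    by (simp add: s_def complex_norm_square del: of_real_power)
  have int3: "integrable N (\<lambda>t. \<Phi> t * cnj (P t))"
    and int4: "integrable N (\<lambda>t. cnj (\<Phi> t) * P t)"
    and int5: "integrable N (\<lambda>t. P t * cnj (P t))"
  proof -
    show *: "integrable N (\<lambda>t. \<Phi> t * cnj (P t))"
    proof -
      have "(\<lambda>t. \<Phi> t * cnj (P t)) = (\<lambda>t. \<Sum>i\<in>I. cnj (a i) * (\<Phi> t * cnj (e i t)))"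
        by (simp add: P_def sum_distrib_left mult_ac)
      thus ?thesis using int1 by simp
    qed
    have "integrable N (\<lambda>t. cnj (\<Phi> t * cnj (P t)))" using * integrable_cnj by blast
    thus "integrable N (\<lambda>t. cnj (\<Phi> t) * P t)" by simp
    have "(\<lambda>t. P t * cnj (P t)) = (\<lambda>t. \<Sum>i\<in>I. \<Sum>j\<in>I. (a i * cnj (a j)) * (e i t * cnj (e j t)))"
      by (simp add: P_def sum_product mult_ac)
    thus "integrable N (\<lambda>t. P t * cnj (P t))" using int2 by simp
  qed
  have c1: "(LINT t|N. \<Phi> t * cnj (P t)) = of_real s"
  proof -
    have "(LINT t|N. \<Phi> t * cnj (P t)) = (LINT t|N. (\<Sum>i\<in>I. cnj (a i) * (\<Phi> t * cnj (e i t))))"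
      by (simp add: P_def sum_distrib_left mult_ac)
    also have "\<dots> = (\<Sum>i\<in>I. cnj (a i) * a i)"
      using int1 by (subst Bochner_Integration.integral_sum) (auto simp: a_def)
    finally show ?thesis by (simp add: s mult_ac)
  qed
  have c2: "(LINT t|N. cnj (\<Phi> t) * P t) = of_real s"
  proof -
    have "(LINT t|N. cnj (\<Phi> t * cnj (P t))) = cnj (of_real s)"
      by (subst Bochner_Integration.integral_cnj) (simp add: c1)
    thus ?thesis by simp
  qed
  have c3: "(LINT t|N. P t * cnj (P t)) = of_real (b * s)"
  proof -
    have "(LINT t|N. P t * cnj (P t)) = (LINT t|N. (\<Sum>i\<in>I. \<Sum>j\<in>I. (a i * cnj (a j)) * (e i t * cnj (e j t))))"
      by (simp add: P_def sum_product mult_ac)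
    also have "\<dots> = (\<Sum>i\<in>I. \<Sum>j\<in>I. (a i * cnj (a j)) * (if i = j then of_real b else 0))"
      using int2 by (simp add: Bochner_Integration.integral_sum orth)
    also have "\<dots> = (\<Sum>i\<in>I. a i * cnj (a i) * of_real b)"
    proof (intro sum.cong refl)
      fix i assume "i \<in> I"
      have "(\<Sum>j\<in>I. (a i * cnj (a j)) * (if i = j then of_real b else 0))
              = (\<Sum>j\<in>I. if i = j then a i * cnj (a j) * of_real b else 0)"
        by (intro sum.cong) auto
      thus "(\<Sum>j\<in>I. (a i * cnj (a j)) * (if i = j then of_real b else 0)) = a i * cnj (a i) * of_real b"
        using I \<open>i \<in> I\<close> by simp
    qed
    finally show ?thesis by (simp add: s sum_distrib_left mult_ac)
  qed
  define n where "n = (LINT t|N. (cmod (\<Phi> t))\<^sup>2)"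
  have c0: "(LINT t|N. \<Phi> t * cnj (\<Phi> t)) = of_real n"
  proof -
    have "(LINT t|N. \<Phi> t * cnj (\<Phi> t)) = (LINT t|N. of_real ((cmod (\<Phi> t))\<^sup>2))"
      by (simp only: complex_norm_square)
    thus ?thesis unfolding n_def by (simp only: integral_complex_of_real)
  qed
  define F where "F = (\<lambda>t. (\<Phi> t - P t / of_real b) * cnj (\<Phi> t - P t / of_real b))"
  have F: "F t = \<Phi> t * cnj (\<Phi> t) - (\<Phi> t * cnj (P t)) / of_real b - (cnj (\<Phi> t) * P t) / of_real b
              + (P t * cnj (P t)) / (of_real b * of_real b)" for t
    by (simp add: F_def diff_divide_distrib ring_distribs)
  have "(LINT t|N. F t) = of_real n - of_real s / of_real b - of_real s / of_real b
          + of_real (b * s) / (of_real b * of_real b)"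
    unfolding F using int0 int3 int4 int5 by (simp add: c0 c1 c2 c3)
  also have "\<dots> = of_real (n - s / b)"
    using b by (simp add: field_simps)
  finally have "of_real (n - s / b) = (LINT t|N. F t)" ..
  also have "\<dots> = (LINT t|N. of_real ((cmod (\<Phi> t - P t / of_real b))\<^sup>2))"
    by (simp only: F_def complex_norm_square)
  also have "\<dots> = of_real (LINT t|N. (cmod (\<Phi> t - P t / of_real b))\<^sup>2)"
    by (simp only: integral_complex_of_real)
  finally have "n - s / b = (LINT t|N. (cmod (\<Phi> t - P t / of_real b))\<^sup>2)"
    by (simp only: of_real_eq_iff)
  also have "\<dots> \<ge> 0" by simp
  finally have "s \<le> b * n" using b by (simp add: field_simps)
  thus ?thesis by (simp add: s_def a_def n_def)
qed

section \<open>Combs and the failure of the lower frame bound\<close>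

text \<open>The test functions for the lower frame bound: narrow bumps of width \<open>\<epsilon>\<close> on the progression with
  step \<open>b = 1 / \<beta>\<close>. The modulations by multiples of \<open>\<beta>\<close> take the same value at corresponding
  points of all bumps, so all bumps enter an inner product with the same phase.\<close>
definition comb :: "(int \<Rightarrow> real) \<Rightarrow> real \<Rightarrow> real \<Rightarrow> real \<Rightarrow> int \<Rightarrow> real \<Rightarrow> complex" where
  "comb c \<xi> b \<epsilon> L x =
     (\<Sum>l=0..<L. of_real (c l) * indicator {\<xi> + b * of_int l..<\<xi> + b * of_int l + \<epsilon>} x)"

lemma comb_measurable [measurable]: "comb c \<xi> b \<epsilon> L \<in> borel_measurable lborel"
  unfolding comb_def by measurable

lemma norm_comb_square:
  assumes c: "\<And>l. \<bar>c l\<bar> = 1" and \<epsilon>: "\<epsilon> \<le> b" and b: "b > 0"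
  shows "(cmod (comb c \<xi> b \<epsilon> L x))\<^sup>2
           = (\<Sum>l=0..<L. indicator {\<xi> + b * of_int l..<\<xi> + b * of_int l + \<epsilon>} x)"
proof (cases "\<exists>l\<in>{0..<L}. x \<in> {\<xi> + b * of_int l..<\<xi> + b * of_int l + \<epsilon>}")
  case False
  hence "comb c \<xi> b \<epsilon> L x = 0" unfolding comb_def by (intro sum.neutral) auto
  moreover have "(\<Sum>l=0..<L. indicator {\<xi> + b * of_int l..<\<xi> + b * of_int l + \<epsilon>} x) = (0::real)"
    using False by (intro sum.neutral) auto
  ultimately show ?thesis by simp
next
  case True
  then obtain l where l: "l \<in> {0..<L}" "x \<in> {\<xi> + b * of_int l..<\<xi> + b * of_int l + \<epsilon>}" by blast
  have disj: "x \<notin> {\<xi> + b * of_int j..<\<xi> + b * of_int j + \<epsilon>}" if "j \<noteq> l" for j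
  proof
    assume j: "x \<in> {\<xi> + b * of_int j..<\<xi> + b * of_int j + \<epsilon>}"
    have "b * of_int j < b * of_int (l + 1)" "b * of_int l < b * of_int (j + 1)"
      using j l(2) \<epsilon> by (auto simp: algebra_simps)
    hence "j < l + 1" "l < j + 1" using b by (simp_all only: mult_less_cancel_left_pos of_int_less_iff)
    thus False using that by linarith
  qed
  have "comb c \<xi> b \<epsilon> L x = of_real (c l)"
    unfolding comb_def using l disj by (subst sum.remove[OF _ l(1)]) (auto intro!: sum.neutral)
  moreover have "(\<Sum>l=0..<L. indicator {\<xi> + b * of_int l..<\<xi> + b * of_int l + \<epsilon>} x) = (1::real)"
    using l disj by (subst sum.remove[OF _ l(1)]) (auto intro!: sum.neutral)
  moreover have "(c l)\<^sup>2 = 1" using c[of l] by (metis power2_abs one_power2)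
  ultimately show ?thesis by simp
qed

lemma comb_L2:
  assumes c: "\<And>l. \<bar>c l\<bar> = 1" and \<epsilon>: "0 < \<epsilon>" "\<epsilon> \<le> b" and b: "b > 0" and L: "L \<ge> 0"
  shows "comb c \<xi> b \<epsilon> L \<in> L2" and "(L2_norm (comb c \<xi> b \<epsilon> L))\<^sup>2 = of_int L * \<epsilon>"
proof -
  have int: "integrable lborel (indicator {\<xi> + b * of_int l..<\<xi> + b * of_int l + \<epsilon>} :: real \<Rightarrow> real)" for l :: int
    using \<epsilon> by (intro integrable_real_indicator) auto
  note eq = norm_comb_square[of c \<epsilon> b \<xi> L, OF c \<epsilon>(2) b]
  have "integrable lborel (\<lambda>x. (cmod (comb c \<xi> b \<epsilon> L x))\<^sup>2)"
    unfolding eq using int by (intro Bochner_Integration.integrable_sum)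
  thus "comb c \<xi> b \<epsilon> L \<in> L2"
    unfolding L2_def by simp
  have "(LINT x|lborel. (cmod (comb c \<xi> b \<epsilon> L x))\<^sup>2) = of_int L * \<epsilon>"
    unfolding eq using int \<epsilon> L by (simp add: Bochner_Integration.integral_sum)
  thus "(L2_norm (comb c \<xi> b \<epsilon> L))\<^sup>2 = of_int L * \<epsilon>"
    unfolding L2_norm_def using L \<epsilon> by simp
qed

text \<open>For \<open>y = \<xi> - \<alpha> * k\<close> this is the sum, over the bumps of the comb, of the values that the window shifted
  by \<open>\<alpha> * k\<close> takes at distance \<open>t\<close> from the left end of the bump.\<close>
definition comb_sample :: "(real \<Rightarrow> real) \<Rightarrow> (int \<Rightarrow> real) \<Rightarrow> real \<Rightarrow> real \<Rightarrow> int \<Rightarrow> real \<Rightarrow> real" where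
  "comb_sample g c b y L t = (\<Sum>l=0..<L. c l * g (y + t + b * of_int l))"

text \<open>Folding all bumps onto one interval turns the inner products with a fixed translate of the window
  into Fourier coefficients of a function of period \<open>b\<close>.\<close>
lemma inner_comb_gabor:
  fixes g :: "real \<Rightarrow> real"
  assumes g: "continuous_on UNIV g" and b: "b > 0" and \<epsilon>: "\<epsilon> > 0"
  shows "cmod (L2_inner (comb c \<xi> b \<epsilon> L) (gabor_system (\<lambda>x. of_real (g x)) \<alpha> (1 / b) (k, m))) =
    cmod (LINT t|lborel. indicator {0..<\<epsilon>} t *\<^sub>R (of_real (comb_sample g c b (\<xi> - \<alpha> * of_int k) L t) *
        cnj (exp (2 * complex_of_real pi * \<i> * of_int m * of_real t / of_real b))))"
proof -
  define E where "E = (\<lambda>t::real. cnj (exp (2 * complex_of_real pi * \<i> * of_int m * of_real t / of_real b)))"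
  define s where "s = (\<lambda>l::int. \<xi> + b * of_int l)"
  define H where "H = (\<lambda>x. E x * of_real (g (x - \<alpha> * of_int k)))"
  have gm: "continuous_on A (\<lambda>x. g (h x))" if "continuous_on A h" for h :: "real \<Rightarrow> real" and A
    using continuous_on_compose2[OF g that] by auto
  have Econt: "continuous_on A E" for A
    unfolding E_def by (intro continuous_intros) (use b in auto)
  \<comment> \<open>the character has period \<open>b\<close>, so the multiples of \<open>b\<close> in \<open>s l\<close> disappear\<close>
  have Eadd: "E (s l + t) = E \<xi> * E t" for l t
  proof -
    have "2 * complex_of_real pi * \<i> * of_int m * of_real (s l + t) / of_real b =
        2 * complex_of_real pi * \<i> * of_int m * of_real \<xi> / of_real b +
        (2 * complex_of_real pi * \<i> * of_int m * of_real t / of_real b + \<i> * (of_int (m * l) * (of_real pi * 2)))"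
      using b by (simp add: s_def field_simps)
    thus ?thesis unfolding E_def by (simp only: exp_add exp_2pi_1_int mult_1_right complex_cnj_mult)
  qed
  have "continuous_on {s l..s l + \<epsilon>} H" for l
    unfolding H_def by (intro continuous_intros Econt gm)
  hence intH: "integrable lborel (\<lambda>x. indicator {s l..<s l + \<epsilon>} x *\<^sub>R H x)" for l
    unfolding set_integrable_def[symmetric]
    by (rule set_integrable_subset[OF borel_integrable_atLeastAtMost']) auto
  have "continuous_on {0..\<epsilon>} (\<lambda>t. E t * of_real (g (s l + t - \<alpha> * of_int k)))" for l
    by (intro continuous_intros Econt gm)
  hence intG: "integrable lborel (\<lambda>t. indicator {0..<\<epsilon>} t *\<^sub>R (E t * of_real (g (s l + t - \<alpha> * of_int k))))" for l
    unfolding set_integrable_def[symmetric]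
    by (rule set_integrable_subset[OF borel_integrable_atLeastAtMost']) auto
  have piece: "(LINT x|lborel. indicator {s l..<s l + \<epsilon>} x *\<^sub>R H x) =
      E \<xi> * (LINT t|lborel. indicator {0..<\<epsilon>} t *\<^sub>R (E t * of_real (g (s l + t - \<alpha> * of_int k))))" for l
  proof -
    have "(LINT x|lborel. indicator {s l..<s l + \<epsilon>} x *\<^sub>R H x)
        = (LINT t|lborel. indicator {s l..<s l + \<epsilon>} (s l + 1 * t) *\<^sub>R H (s l + 1 * t))"
      by (subst lborel_integral_real_affine[where c = 1 and t = "s l"]) auto
    also have "\<dots> = (LINT t|lborel. E \<xi> * (indicator {0..<\<epsilon>} t *\<^sub>R (E t * of_real (g (s l + t - \<alpha> * of_int k)))))"
      by (intro Bochner_Integration.integral_cong) (auto simp: H_def Eadd indicator_def)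
    also have "\<dots> = E \<xi> * (LINT t|lborel. indicator {0..<\<epsilon>} t *\<^sub>R (E t * of_real (g (s l + t - \<alpha> * of_int k))))"
      using intG by (intro Bochner_Integration.integral_mult_right)
    finally show ?thesis .
  qed
  have "L2_inner (comb c \<xi> b \<epsilon> L) (gabor_system (\<lambda>x. of_real (g x)) \<alpha> (1 / b) (k, m))
      = (LINT x|lborel. (\<Sum>l=0..<L. of_real (c l) * (indicator {s l..<s l + \<epsilon>} x *\<^sub>R H x)))"
    unfolding L2_inner_def comb_def sum_distrib_right
  proof (intro Bochner_Integration.integral_cong refl sum.cong)
    fix x l
    show "of_real (c l) * indicator {\<xi> + b * of_int l..<\<xi> + b * of_int l + \<epsilon>} x *
            cnj (gabor_system (\<lambda>x. of_real (g x)) \<alpha> (1 / b) (k, m) x)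
          = of_real (c l) * (indicator {s l..<s l + \<epsilon>} x *\<^sub>R H x)"
      by (cases "x \<in> {s l..<s l + \<epsilon>}") (simp_all add: s_def H_def E_def gabor_system_def)
  qed
  also have "\<dots> = (\<Sum>l=0..<L. of_real (c l) * (LINT x|lborel. indicator {s l..<s l + \<epsilon>} x *\<^sub>R H x))"
    by (subst Bochner_Integration.integral_sum)
       (intro integrable_mult_right intH, simp only: integral_mult_right_zero)
  also have "\<dots> = E \<xi> * (\<Sum>l=0..<L. of_real (c l) *
      (LINT t|lborel. indicator {0..<\<epsilon>} t *\<^sub>R (E t * of_real (g (s l + t - \<alpha> * of_int k)))))"
    unfolding piece by (simp add: sum_distrib_left mult_ac)
  also have "(\<Sum>l=0..<L. of_real (c l) *
      (LINT t|lborel. indicator {0..<\<epsilon>} t *\<^sub>R (E t * of_real (g (s l + t - \<alpha> * of_int k)))))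
    = (LINT t|lborel. (\<Sum>l=0..<L. of_real (c l) * (indicator {0..<\<epsilon>} t *\<^sub>R (E t * of_real (g (s l + t - \<alpha> * of_int k))))))"
    by (subst Bochner_Integration.integral_sum)
       (intro integrable_mult_right intG, simp only: integral_mult_right_zero)
  also have "\<dots> = (LINT t|lborel. indicator {0..<\<epsilon>} t *\<^sub>R (of_real (comb_sample g c b (\<xi> - \<alpha> * of_int k) L t) * E t))"
    by (intro Bochner_Integration.integral_cong)
       (auto simp: comb_sample_def s_def sum_distrib_left indicator_def algebra_simps intro!: sum.cong)
  finally have *: "L2_inner (comb c \<xi> b \<epsilon> L) (gabor_system (\<lambda>x. of_real (g x)) \<alpha> (1 / b) (k, m)) =
      E \<xi> * (LINT t|lborel. indicator {0..<\<epsilon>} t *\<^sub>R (of_real (comb_sample g c b (\<xi> - \<alpha> * of_int k) L t) * E t))" .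
  have "2 * complex_of_real pi * \<i> * of_int m * of_real \<xi> / of_real b = \<i> * of_real (2 * pi * of_int m * \<xi> / b)"
    by simp
  hence "cmod (E \<xi>) = 1"
    unfolding E_def by (simp only: complex_mod_cnj norm_exp_i_times)
  thus ?thesis unfolding * E_def by (simp add: norm_mult)
qed

lemma sum_inner_comb_gabor_le:
  fixes g :: "real \<Rightarrow> real"
  assumes g: "continuous_on UNIV g" and gC: "\<And>x. \<bar>g x\<bar> \<le> C"
    and c: "\<And>l. \<bar>c l\<bar> = 1" and \<epsilon>: "0 < \<epsilon>" "\<epsilon> \<le> b" and M: "finite M"
  shows "(\<Sum>m\<in>M. (cmod (L2_inner (comb c \<xi> b \<epsilon> L)
            (gabor_system (\<lambda>x. of_real (g x)) \<alpha> (1 / b) (k, m))))\<^sup>2)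
       \<le> b * (LINT t|lborel. indicator {0..<\<epsilon>} t * (comb_sample g c b (\<xi> - \<alpha> * of_int k) L t)\<^sup>2)"
proof -
  have b: "b > 0" using \<epsilon> by simp
  define N where "N = restrict_space lborel {0..b}"
  define e where "e = (\<lambda>(m::int) (t::real). exp (2 * complex_of_real pi * \<i> * of_int m * of_real t / of_real b))"
  define \<Phi> :: "real \<Rightarrow> complex" where
    "\<Phi> = (\<lambda>t. of_real (indicator {0..<\<epsilon>} t * comb_sample g c b (\<xi> - \<alpha> * of_int k) L t))"
  have intN: "(LINT t|N. F t) = (LINT t|lborel. indicator {0..b} t *\<^sub>R F t)" for F :: "real \<Rightarrow> 'z::{banach,second_countable_topology}"
    unfolding N_def by (rule integral_restrict_space) simp
  have [measurable]: "g \<in> borel_measurable borel"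
    using g by (rule borel_measurable_continuous_onI)
  have fin: "finite_measure N"
    unfolding N_def by (rule finite_measureI) (use b in \<open>simp add: emeasure_restrict_space space_restrict_space\<close>)
  have em: "e m \<in> borel_measurable N" for m
  proof -
    have "e m \<in> borel_measurable borel"
      unfolding e_def by (intro borel_measurable_continuous_onI continuous_intros) (use b in auto)
    thus ?thesis unfolding N_def by (intro measurable_restrict_space1) simp
  qed
  have e1: "cmod (e m t) = 1" for m t
  proof -
    have "2 * complex_of_real pi * \<i> * of_int m * of_real t / of_real b = \<i> * of_real (2 * pi * of_int m * t / b)"
      by simp
    thus ?thesis unfolding e_def by (simp only: norm_exp_i_times)
  qed
  have orth: "(LINT t|N. e i t * cnj (e j t)) = (if i = j then of_real b else 0)" for i j
  proof -
    have "e i t * cnj (e j t) = exp (2 * complex_of_real pi * \<i> * of_int (i - j) * of_real t / of_real b)" for t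
      using b by (simp add: e_def exp_cnj mult_exp_exp field_simps)
    thus ?thesis
      unfolding intN by (simp only: integral_character_period[OF b]) auto
  qed
  have \<Phi>m: "\<Phi> \<in> borel_measurable N"
    unfolding \<Phi>_def comb_sample_def N_def by (intro measurable_restrict_space1) measurable
  have \<Phi>b: "cmod (\<Phi> t) \<le> (\<Sum>l=0..<L. C)" for t
  proof -
    have "cmod (\<Phi> t) \<le> \<bar>comb_sample g c b (\<xi> - \<alpha> * of_int k) L t\<bar>"
      by (auto simp: \<Phi>_def indicator_def)
    also have "\<dots> \<le> (\<Sum>l=0..<L. C)"
      unfolding comb_sample_def
    proof (rule order_trans[OF sum_abs], rule sum_mono)
      show "\<bar>c l * g (\<xi> - \<alpha> * of_int k + t + b * of_int l)\<bar> \<le> C" for l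
        using gC c by (simp add: abs_mult)
    qed
    finally show ?thesis .
  qed
  have e1': "cmod (e m t) \<le> 1" for m t using e1 by simp
  have "(\<Sum>m\<in>M. (cmod (LINT t|N. \<Phi> t * cnj (e m t)))\<^sup>2) \<le> b * (LINT t|N. (cmod (\<Phi> t))\<^sup>2)"
    by (rule bessel_inequality[OF fin \<Phi>m \<Phi>b em e1' orth b M])
  also have "(LINT t|N. (cmod (\<Phi> t))\<^sup>2)
      = (LINT t|lborel. indicator {0..<\<epsilon>} t * (comb_sample g c b (\<xi> - \<alpha> * of_int k) L t)\<^sup>2)"
    unfolding intN using \<epsilon>
    by (intro Bochner_Integration.integral_cong) (auto simp: \<Phi>_def indicator_def abs_mult power_mult_distrib)
  also have "(\<lambda>m. LINT t|N. \<Phi> t * cnj (e m t)) = (\<lambda>m. LINT t|lborel. indicator {0..<\<epsilon>} t *\<^sub>R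
        (of_real (comb_sample g c b (\<xi> - \<alpha> * of_int k) L t) * cnj (e m t)))"
    unfolding intN using \<epsilon>
    by (intro ext Bochner_Integration.integral_cong) (auto simp: \<Phi>_def indicator_def)
  finally show ?thesis
    unfolding inner_comb_gabor[OF g b \<epsilon>(1)] e_def .
qed

text \<open>Both sides of the lower frame inequality are proportional to \<open>\<epsilon>\<close>: the squared norm of the comb is
  \<open>L * \<epsilon>\<close>, and Bessel's inequality bounds the coefficients by an integral over an interval of length
  \<open>\<epsilon>\<close>. So \<open>\<epsilon>\<close> cancels and only pointwise values of the samples remain.\<close>
lemma frame_lower_bound_comb:
  fixes g :: "real \<Rightarrow> real"
  assumes g: "continuous_on UNIV g" and gC: "\<And>x. \<bar>g x\<bar> \<le> C"
    and c: "\<And>l. \<bar>c l\<bar> = 1" and \<epsilon>: "0 < \<epsilon>" "\<epsilon> \<le> b" and L: "L \<ge> 0"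
    and \<eta>: "\<And>t K. 0 \<le> t \<Longrightarrow> t < \<epsilon> \<Longrightarrow> finite K \<Longrightarrow>
               (\<Sum>k\<in>K. (comb_sample g c b (\<xi> - \<alpha> * of_int k) L t)\<^sup>2) \<le> \<eta>"
    and summ: "(\<lambda>i. (cmod (L2_inner (comb c \<xi> b \<epsilon> L) (gabor_system (\<lambda>x. of_real (g x)) \<alpha> (1 / b) i)))\<^sup>2) summable_on UNIV"
    and A: "A * (L2_norm (comb c \<xi> b \<epsilon> L))\<^sup>2 \<le>
         (\<Sum>\<^sub>\<infinity>i. (cmod (L2_inner (comb c \<xi> b \<epsilon> L) (gabor_system (\<lambda>x. of_real (g x)) \<alpha> (1 / b) i)))\<^sup>2)"
  shows "A * of_int L \<le> b * \<eta>"
proof -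
  have b: "b > 0" using \<epsilon> by simp
  define I where "I = (\<lambda>i. (cmod (L2_inner (comb c \<xi> b \<epsilon> L) (gabor_system (\<lambda>x. of_real (g x)) \<alpha> (1 / b) i)))\<^sup>2)"
  define G where "G = (\<lambda>k t. comb_sample g c b (\<xi> - \<alpha> * of_int k) L t)"
  have Gc: "continuous_on A' (G k)" for k A'
    unfolding G_def comb_sample_def
    by (intro continuous_intros continuous_on_compose2[OF g]) auto
  have Gi: "integrable lborel (\<lambda>t. indicator {0..<\<epsilon>} t * (G k t)\<^sup>2)" for k
  proof -
    have "continuous_on {0..\<epsilon>} (\<lambda>t. (G k t)\<^sup>2)" by (intro continuous_intros Gc)
    hence "set_integrable lborel {0..<\<epsilon>} (\<lambda>t. (G k t)\<^sup>2)"
      by (rule set_integrable_subset[OF borel_integrable_atLeastAtMost']) auto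
    thus ?thesis by (simp add: set_integrable_def)
  qed
  have "sum I F \<le> b * (\<eta> * \<epsilon>)" if F: "finite F" for F
  proof -
    define K M where "K = fst ` F" and "M = snd ` F"
    have KM: "finite K" "finite M" "F \<subseteq> K \<times> M" using F by (force simp: K_def M_def)+
    have "sum I F \<le> sum I (K \<times> M)"
      by (rule sum_mono2) (use KM in \<open>auto simp: I_def\<close>)
    also have "\<dots> = (\<Sum>k\<in>K. \<Sum>m\<in>M. I (k, m))"
      by (simp add: sum.cartesian_product)
    also have "\<dots> \<le> (\<Sum>k\<in>K. b * (LINT t|lborel. indicator {0..<\<epsilon>} t * (G k t)\<^sup>2))"
      unfolding I_def G_def by (intro sum_mono sum_inner_comb_gabor_le[OF g gC c \<epsilon> KM(2)])
    also have "\<dots> = b * (LINT t|lborel. (\<Sum>k\<in>K. indicator {0..<\<epsilon>} t * (G k t)\<^sup>2))"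
      using Gi by (simp add: Bochner_Integration.integral_sum sum_distrib_left)
    also have "\<dots> \<le> b * (LINT t|lborel. indicator {0..<\<epsilon>} t * \<eta>)"
    proof (intro mult_left_mono integral_mono)
      show "integrable lborel (\<lambda>t. \<Sum>k\<in>K. indicator {0..<\<epsilon>} t * (G k t)\<^sup>2)"
        using Gi by (rule Bochner_Integration.integrable_sum)
      show "(\<Sum>k\<in>K. indicator {0..<\<epsilon>} t * (G k t)\<^sup>2) \<le> indicator {0..<\<epsilon>} t * \<eta>" for t
        using \<eta>[of t K] KM(1) by (cases "t \<in> {0..<\<epsilon>}") (auto simp: G_def)
      show "integrable lborel (\<lambda>t. indicator {0..<\<epsilon>} t * \<eta>)"
        using \<epsilon> by (intro integrable_mult_left integrable_real_indicator) auto
    qed (use b in auto)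
    also have "(LINT t|lborel. indicator {0..<\<epsilon>} t * \<eta>) = \<eta> * \<epsilon>"
      using \<epsilon> by simp
    finally show ?thesis .
  qed
  hence "infsum I UNIV \<le> b * (\<eta> * \<epsilon>)"
    using summ unfolding I_def by (intro infsum_le_finite_sums) auto
  hence "A * (L2_norm (comb c \<xi> b \<epsilon> L))\<^sup>2 \<le> b * (\<eta> * \<epsilon>)"
    using A unfolding I_def by linarith
  hence "(A * of_int L) * \<epsilon> \<le> (b * \<eta>) * \<epsilon>"
    using comb_L2(2)[OF c \<epsilon> b L] by (simp add: mult_ac)
  thus ?thesis using \<epsilon> by simp
qed

lemma summable_on_finite_sum:
  fixes f :: "'i \<Rightarrow> 'j \<Rightarrow> real"
  assumes "finite I" "\<And>i. i \<in> I \<Longrightarrow> f i summable_on A"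
  shows "(\<lambda>k. \<Sum>i\<in>I. f i k) summable_on A"
  using assms by (induction I rule: finite_induct) (auto intro: summable_on_add)

text \<open>As \<open>L\<close> grows, the lower frame bound demands that the sum of the squared comb samples grows
  linearly in \<open>L\<close>. At \<open>t = 0\<close> each sample is a block of a family with sum zero, hence is only felt
  by the translates near the two ends of the comb, and the sum of squares is bounded uniformly in
  \<open>L\<close>. Continuity in \<open>t\<close> carries this over to short bumps. When \<open>c l = z ^ l\<close> for a fixed number \<open>z\<close>
  of modulus one, the hypothesis says that the Zak transform of \<open>g\<close> vanishes at a point
  and at its translates by multiples of \<open>\<alpha>\<close> in the first variable.\<close>
lemma not_frame_if_shifted_sums_vanish:
  fixes g :: "real \<Rightarrow> real" and q :: int
  assumes g: "continuous_on UNIV g" and gC: "\<And>x. \<bar>g x\<bar> \<le> C * exp (- \<bar>x\<bar>)"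
    and \<alpha>: "\<alpha> > 0" and q: "q > 0" and c: "\<And>l. \<bar>c l\<bar> = 1"
    and zero: "\<And>k. ((\<lambda>l. c l * g (\<xi> + \<alpha> * of_int (q * l - k))) has_sum 0) UNIV"
  shows "\<not> L2_frame (gabor_system (\<lambda>x. complex_of_real (g x)) \<alpha> (1 / (\<alpha> * of_int q)))"
proof
  define b where "b = \<alpha> * of_int q"
  have b: "b > 0" using \<alpha> q by (simp add: b_def)
  assume "L2_frame (gabor_system (\<lambda>x. complex_of_real (g x)) \<alpha> (1 / (\<alpha> * of_int q)))"
  then obtain A where A: "A > 0" and frame:
    "\<And>f. f \<in> L2 \<Longrightarrow> (\<lambda>i. (cmod (L2_inner f (gabor_system (\<lambda>x. of_real (g x)) \<alpha> (1 / b) i)))\<^sup>2) summable_on UNIV"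
    "\<And>f. f \<in> L2 \<Longrightarrow> A * (L2_norm f)\<^sup>2 \<le>
         (\<Sum>\<^sub>\<infinity>i. (cmod (L2_inner f (gabor_system (\<lambda>x. of_real (g x)) \<alpha> (1 / b) i)))\<^sup>2)"
    unfolding L2_frame_def b_def[symmetric] by blast
  have C: "C \<ge> 0" using gC[of 0] by simp
  have gC': "\<bar>g x\<bar> \<le> C" for x
  proof -
    have "C * exp (- \<bar>x\<bar>) \<le> C * 1" using C by (intro mult_left_mono) auto
    thus ?thesis using gC[of x] by simp
  qed
  define G where "G = (\<lambda>L k t. comb_sample g c b (\<xi> - \<alpha> * of_int k) L t)"
  define D where "D = 2 * (C / (1 - exp (- b)))\<^sup>2"
  define w where "w = (\<lambda>k::int. exp (- 2 * \<bar>\<alpha> * of_int k - \<xi>\<bar>))"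
  have w: "w summable_on UNIV"
  proof (rule exp_decay_summable)
    show "\<bar>w k\<bar> \<le> 1 * exp (- \<bar>(2 * \<alpha>) * of_int k - 2 * \<xi>\<bar>)" for k
      by (auto simp: w_def abs_if)
  qed (use \<alpha> in simp)
  define B where "B = 2 * D * infsum w UNIV"
  \<comment> \<open>the bound \<open>B\<close> does not depend on \<open>L\<close>\<close>
  have at0: "infsum (\<lambda>k. (G L k 0)\<^sup>2) UNIV \<le> B" if L: "L \<ge> 0" for L
  proof -
    have le: "(G L k 0)\<^sup>2 \<le> D * (w k + w (k - q * L))" for k
    proof -
      have "\<bar>c l * g (\<xi> + \<alpha> * of_int (q * l - k))\<bar> \<le> C * exp (- \<bar>b * of_int l - (\<alpha> * of_int k - \<xi>)\<bar>)" for l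
        using gC[of "\<xi> + \<alpha> * of_int (q * l - k)"] c[of l] by (simp add: abs_mult b_def algebra_simps)
      from null_sum_block_bound[OF b this zero L]
      show ?thesis
        by (simp add: G_def comb_sample_def D_def w_def b_def algebra_simps)
    qed
    have shift: "((\<lambda>k. w (k - q * L)) has_sum infsum w UNIV) UNIV"
    proof -
      have "((\<lambda>k. w (k - q * L)) has_sum infsum w UNIV) UNIV \<longleftrightarrow> (w has_sum infsum w UNIV) UNIV"
        by (rule has_sum_reindex_bij_witness[of _ "\<lambda>k. k + q * L" "\<lambda>k. k - q * L"]) auto
      thus ?thesis using w by simp
    qed
    have hs: "((\<lambda>k. D * (w k + w (k - q * L))) has_sum (D * (infsum w UNIV + infsum w UNIV))) UNIV"
      by (intro has_sum_cmult_right has_sum_add shift has_sum_infsum w)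
    hence "(\<lambda>k. (G L k 0)\<^sup>2) summable_on UNIV"
      by (rule summable_on_comparison_test[OF has_sum_imp_summable]) (use le in auto)
    hence "infsum (\<lambda>k. (G L k 0)\<^sup>2) UNIV \<le> D * (infsum w UNIV + infsum w UNIV)"
      by (intro has_sum_mono[OF has_sum_infsum hs]) (use le in auto)
    thus ?thesis by (simp add: B_def)
  qed
  obtain L :: int where L: "2 * b * B / A < of_int L" "L > 0"
  proof -
    obtain n :: int where "2 * b * B / A < of_int n" using ex_less_of_int by blast
    thus ?thesis using that[of "max n 1"] by (auto simp: less_max_iff_disj)
  qed
  \<comment> \<open>half of the value that the lower frame bound would force\<close>
  define \<eta> where "\<eta> = A * of_int L / (2 * b)"
  have \<eta>: "B < \<eta>" using L A b by (simp add: \<eta>_def field_simps)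
  define S where "S = (\<lambda>t. infsum (\<lambda>k. (G L k t)\<^sup>2) UNIV)"
  define P where "P = (\<lambda>k::int. \<Sum>l=0..<L. exp 1 * C * exp (- \<bar>\<alpha> * of_int k - (\<xi> + b * of_int l)\<bar>))"
  \<comment> \<open>moving the argument by at most 1 costs a factor \<open>exp 1\<close> in the decay bound\<close>
  have GP: "\<bar>G L k t\<bar> \<le> P k" if t: "t \<in> {0..1}" for k t
  proof -
    have "\<bar>c l * g (\<xi> - \<alpha> * of_int k + t + b * of_int l)\<bar>
            \<le> exp 1 * C * exp (- \<bar>\<alpha> * of_int k - (\<xi> + b * of_int l)\<bar>)" for l
    proof -
      have "- \<bar>\<xi> - \<alpha> * of_int k + t + b * of_int l\<bar> \<le> 1 + - \<bar>\<alpha> * of_int k - (\<xi> + b * of_int l)\<bar>"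
        using t by (auto simp: abs_if)
      hence "exp (- \<bar>\<xi> - \<alpha> * of_int k + t + b * of_int l\<bar>) \<le> exp 1 * exp (- \<bar>\<alpha> * of_int k - (\<xi> + b * of_int l)\<bar>)"
        by (simp only: mult_exp_exp exp_le_cancel_iff)
      hence "C * exp (- \<bar>\<xi> - \<alpha> * of_int k + t + b * of_int l\<bar>) \<le> C * (exp 1 * exp (- \<bar>\<alpha> * of_int k - (\<xi> + b * of_int l)\<bar>))"
        using C by (rule mult_left_mono)
      thus ?thesis using gC[of "\<xi> - \<alpha> * of_int k + t + b * of_int l"] c[of l] by (simp add: abs_mult mult_ac)
    qed
    thus ?thesis unfolding G_def comb_sample_def P_def
      by (intro order_trans[OF sum_abs] sum_mono)
  qed
  have Ps: "P summable_on UNIV"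
    unfolding P_def
  proof (intro summable_on_finite_sum)
    fix l
    show "(\<lambda>k::int. exp 1 * C * exp (- \<bar>\<alpha> * of_int k - (\<xi> + b * of_int l)\<bar>)) summable_on UNIV"
      by (rule exp_decay_summable[OF \<alpha>, where C = "exp 1 * C"]) (use C in auto)
  qed simp
  define Pm where "Pm = (\<Sum>l=0..<L. exp 1 * C)"
  have Pm: "0 \<le> P k" "P k \<le> Pm" for k
  proof -
    show "0 \<le> P k" unfolding P_def using C by (intro sum_nonneg) auto
    show "P k \<le> Pm" unfolding P_def Pm_def
      using C by (intro sum_mono) (auto intro!: mult_left_le)
  qed
  have GM: "\<bar>(G L k t)\<^sup>2\<bar> \<le> Pm * P k" if "t \<in> {0..1}" for k t
  proof -
    have "\<bar>G L k t\<bar> * \<bar>G L k t\<bar> \<le> Pm * P k"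
      using GP[OF that, of k] Pm[of k] by (intro mult_mono) auto
    thus ?thesis by (simp add: power2_eq_square abs_mult)
  qed
  have PmP: "(\<lambda>k. Pm * P k) summable_on UNIV" using Ps by (rule summable_on_cmult_right)
  have Gcont: "continuous_on {0..1} (\<lambda>t. (G L k t)\<^sup>2)" for k
    unfolding G_def comb_sample_def
    by (intro continuous_intros continuous_on_compose2[OF g]) auto
  have Scont: "continuous_on {0..1} S"
    unfolding S_def by (rule continuous_on_infsum_M_test[OF GM PmP Gcont])
  have "S 0 < \<eta>" using at0[of L] L \<eta> by (simp add: S_def)
  then obtain d where d: "d > 0" "\<And>t. t \<in> {0..1} \<Longrightarrow> dist t 0 < d \<Longrightarrow> dist (S t) (S 0) < \<eta> - S 0"
    using Scont[unfolded continuous_on_iff, rule_format, of 0 "\<eta> - S 0"] by auto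
  define \<epsilon> where "\<epsilon> = min (min d 1) b"
  have \<epsilon>: "0 < \<epsilon>" "\<epsilon> \<le> b" "\<epsilon> \<le> d" "\<epsilon> \<le> 1" using d b by (auto simp: \<epsilon>_def)
  have "(\<Sum>k\<in>K. (comb_sample g c b (\<xi> - \<alpha> * of_int k) L t)\<^sup>2) \<le> \<eta>"
    if t: "0 \<le> t" "t < \<epsilon>" and K: "finite K" for t K
  proof -
    have t': "t \<in> {0..1}" using t \<epsilon> by auto
    have "(\<Sum>k\<in>K. (G L k t)\<^sup>2) \<le> S t"
      unfolding S_def
    proof (rule finite_sum_le_infsum)
      show "(\<lambda>k. (G L k t)\<^sup>2) summable_on UNIV"
        by (rule summable_on_comparison_test[OF PmP]) (use GM[OF t'] in auto)
    qed (use K in auto)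
    also have "S t \<le> \<eta>"
      using d(2)[OF t'] t \<epsilon> by (auto simp: dist_real_def)
    finally show ?thesis by (simp add: G_def)
  qed
  hence "A * of_int L \<le> b * \<eta>"
    using L by (intro frame_lower_bound_comb[OF g gC' c \<epsilon>(1,2) _ _ frame(1) frame(2)] comb_L2(1)[OF c \<epsilon>(1,2) b]) auto
  thus False using A L b by (simp add: \<eta>_def)
qed

section \<open>Hermite functions\<close>

text \<open>In the usual normalisation these are \<open>sqrt (2 * pi) ^ n * H n (sqrt (2 * pi) * x)\<close>, with \<open>H n\<close> the
  physicists' Hermite polynomials.\<close>
fun hermite_poly :: "nat \<Rightarrow> real poly" where
  "hermite_poly 0 = 1"
| "hermite_poly (Suc n) = [:0, 4 * pi:] * hermite_poly n - pderiv (hermite_poly n)"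

declare hermite_poly.simps(2) [simp del]

abbreviation hermite_window :: "nat \<Rightarrow> real \<Rightarrow> real" where
  "hermite_window n x \<equiv> poly (hermite_poly n) x * exp (- pi * x\<^sup>2)"

lemma gaussian_poly_deriv:
  "((\<lambda>x. poly p x * exp (- \<kappa> * x\<^sup>2)) has_real_derivative
      (poly (pderiv p) x - 2 * \<kappa> * x * poly p x) * exp (- \<kappa> * x\<^sup>2)) (at x)"
  by (auto intro!: derivative_eq_intros poly_DERIV simp: algebra_simps)

lemma deriv_iterate_gaussian:
  "(deriv ^^ n) (\<lambda>t. exp (- 2 * pi * t\<^sup>2))
     = (\<lambda>x. (- 1) ^ n * (poly (hermite_poly n) x * exp (- (2 * pi) * x\<^sup>2)))"
proof (induction n)
  case (Suc n)
  have "deriv (\<lambda>x. (- 1) ^ n * (poly (hermite_poly n) x * exp (- (2 * pi) * x\<^sup>2))) x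
      = (- 1) ^ Suc n * (poly (hermite_poly (Suc n)) x * exp (- (2 * pi) * x\<^sup>2))" for x
    by (rule DERIV_imp_deriv, rule DERIV_cong, rule DERIV_cmult, rule gaussian_poly_deriv)
       (simp add: hermite_poly.simps(2) algebra_simps)
  thus ?case by (intro ext) (simp only: funpow.simps o_apply Suc.IH)
qed auto

lemma hermite_function_eq:
  "hermite_function n x = hermite_const n powr (- 1 / 2) * hermite_window n x"
proof -
  have "hermite_function n x = ((- 1) ^ n * (- 1) ^ n) * hermite_const n powr (- 1 / 2) *
      (poly (hermite_poly n) x * (exp (pi * x\<^sup>2) * exp (- (2 * pi) * x\<^sup>2)))"
    unfolding hermite_function_def deriv_iterate_gaussian by (simp add: mult_ac)
  also have "exp (pi * x\<^sup>2) * exp (- (2 * pi) * x\<^sup>2) = exp (- pi * x\<^sup>2)"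
    by (simp add: mult_exp_exp algebra_simps)
  also have "(- 1) ^ n * (- 1) ^ n = (1 :: real)"
    by (simp flip: power_mult_distrib)
  finally show ?thesis by simp
qed

lemma pderiv_hermite_poly_Suc:
  "pderiv (hermite_poly (Suc n)) = smult (4 * pi * real (Suc n)) (hermite_poly n)"
proof (induction n)
  case 0
  show ?case by (simp add: hermite_poly.simps(2) pderiv_pCons)
next
  case (Suc n)
  have "pderiv (hermite_poly (Suc (Suc n))) = smult (4 * pi) (hermite_poly (Suc n))
      + [:0, 4 * pi:] * pderiv (hermite_poly (Suc n)) - pderiv (pderiv (hermite_poly (Suc n)))"
    by (subst hermite_poly.simps(2)) (simp only: pderiv_diff pderiv_mult, simp add: pderiv_pCons)
  also have "\<dots> = smult (4 * pi) (hermite_poly (Suc n))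
      + smult (4 * pi * real (Suc n)) ([:0, 4 * pi:] * hermite_poly n - pderiv (hermite_poly n))"
    by (simp only: Suc.IH pderiv_smult mult_smult_right smult_diff_right add_diff_eq)
  also have "[:0, 4 * pi:] * hermite_poly n - pderiv (hermite_poly n) = hermite_poly (Suc n)"
    by (simp only: hermite_poly.simps(2))
  also have "smult (4 * pi) (hermite_poly (Suc n)) + smult (4 * pi * real (Suc n)) (hermite_poly (Suc n))
      = smult (4 * pi * real (Suc (Suc n))) (hermite_poly (Suc n))"
    by (simp only: smult_add_left[symmetric]) (simp add: algebra_simps)
  finally show ?case .
qed

lemma hermite_poly_ode:
  "poly (pderiv (pderiv (hermite_poly n))) x =
     4 * pi * x * poly (pderiv (hermite_poly n)) x - 4 * pi * real n * poly (hermite_poly n) x"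
proof -
  have "poly (pderiv (hermite_poly (Suc n))) x = 4 * pi * poly (hermite_poly n) x
      + 4 * pi * x * poly (pderiv (hermite_poly n)) x - poly (pderiv (pderiv (hermite_poly n))) x"
    by (subst hermite_poly.simps(2)) (simp only: pderiv_diff pderiv_mult, simp add: pderiv_pCons)
  thus ?thesis
    unfolding pderiv_hermite_poly_Suc by (simp add: algebra_simps)
qed

lemma hermite_poly_uminus: "poly (hermite_poly n) (- x) = (- 1) ^ n * poly (hermite_poly n) x"
proof (induction n rule: induct_nat_012)
  case (ge2 n)
  have rec: "poly (hermite_poly (Suc (Suc n))) y = 4 * pi * y * poly (hermite_poly (Suc n)) y
      - 4 * pi * real (Suc n) * poly (hermite_poly n) y" for y
    by (subst hermite_poly.simps(2)) (simp only: pderiv_hermite_poly_Suc, simp)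
  show ?case unfolding rec ge2 by (simp add: algebra_simps)
qed (auto simp: hermite_poly.simps(2))

lemma hermite_poly_lead_coeff_pos: "lead_coeff (hermite_poly n) > 0"
proof -
  have "degree (hermite_poly n) = n \<and> lead_coeff (hermite_poly n) > 0"
  proof (induction n)
    case (Suc n)
    have deg: "degree ([:0, 4 * pi:] * hermite_poly n) = Suc n"
      using Suc by (subst degree_mult_eq) auto
    have "degree (pderiv (hermite_poly n)) < Suc n"
      using Suc by (simp add: degree_pderiv)
    hence less: "degree (- pderiv (hermite_poly n)) < degree ([:0, 4 * pi:] * hermite_poly n)"
      unfolding deg by simp
    have eq: "hermite_poly (Suc n) = - pderiv (hermite_poly n) + [:0, 4 * pi:] * hermite_poly n"
      by (simp add: hermite_poly.simps(2))
    have "lead_coeff (hermite_poly (Suc n)) = lead_coeff ([:0, 4 * pi:] * hermite_poly n)"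
      unfolding eq by (rule lead_coeff_add_le[OF less])
    moreover have "degree (hermite_poly (Suc n)) = Suc n"
      unfolding eq using degree_add_eq_right[OF less] deg by simp
    moreover have "coeff (hermite_poly n) n > 0" using Suc by metis
    ultimately show ?case
      using Suc by (simp only: lead_coeff_mult) simp
  qed auto
  thus ?thesis ..
qed

lemma hermite_poly_eventually_pos:
  obtains \<delta> X where "\<delta> > 0" "\<And>x. x \<ge> X \<Longrightarrow> poly (hermite_poly n) x \<ge> \<delta>"
  using poly_pinfty_gt_lc[OF hermite_poly_lead_coeff_pos] hermite_poly_lead_coeff_pos that by metis

lemma poly_exp_bound: "\<exists>C k. C \<ge> 0 \<and> (\<forall>x::real. \<bar>poly p x\<bar> \<le> C * exp (real k * \<bar>x\<bar>))"
proof (induction p)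
  case (pCons a p)
  then obtain C k where C: "C \<ge> 0" "\<And>x. \<bar>poly p x\<bar> \<le> C * exp (real k * \<bar>x\<bar>)" by blast
  have "\<bar>poly (pCons a p) x\<bar> \<le> (\<bar>a\<bar> + C) * exp (real (Suc k) * \<bar>x\<bar>)" for x
  proof -
    have "\<bar>poly (pCons a p) x\<bar> \<le> \<bar>a\<bar> + \<bar>x\<bar> * \<bar>poly p x\<bar>"
      using abs_triangle_ineq[of a "x * poly p x"] by (simp add: abs_mult)
    also have "\<dots> \<le> \<bar>a\<bar> * exp (real (Suc k) * \<bar>x\<bar>) + exp \<bar>x\<bar> * (C * exp (real k * \<bar>x\<bar>))"
    proof (intro add_mono mult_mono C(2))
      show "\<bar>a\<bar> \<le> \<bar>a\<bar> * exp (real (Suc k) * \<bar>x\<bar>)" by (simp add: mult_le_cancel_left1)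
      show "\<bar>x\<bar> \<le> exp \<bar>x\<bar>" using exp_ge_add_one_self[of "\<bar>x\<bar>"] by linarith
    qed auto
    also have "exp \<bar>x\<bar> * (C * exp (real k * \<bar>x\<bar>)) = C * exp (real (Suc k) * \<bar>x\<bar>)"
      by (simp add: exp_add ring_distribs)
    also have "\<bar>a\<bar> * exp (real (Suc k) * \<bar>x\<bar>) + \<dots> = (\<bar>a\<bar> + C) * exp (real (Suc k) * \<bar>x\<bar>)"
      by (rule ring_distribs(2)[symmetric])
    finally show ?thesis .
  qed
  thus ?case using C(1) by (intro exI[of _ "\<bar>a\<bar> + C"] exI[of _ "Suc k"]) auto
qed (auto intro!: exI[of _ 0])

lemma poly_gaussian_decay:
  fixes p :: "real poly"
  assumes "\<kappa> \<ge> 1"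
  obtains C where "C \<ge> 0" "\<And>x. \<bar>poly p x * exp (- \<kappa> * x\<^sup>2)\<bar> \<le> C * exp (- \<bar>x\<bar>)"
proof -
  obtain C k where C: "C \<ge> 0" "\<And>x. \<bar>poly p x\<bar> \<le> C * exp (real k * \<bar>x\<bar>)"
    using poly_exp_bound by blast
  define K where "K = real k + 1"
  have "\<bar>poly p x * exp (- \<kappa> * x\<^sup>2)\<bar> \<le> C * exp (K\<^sup>2) * exp (- \<bar>x\<bar>)" for x
  proof -
    have "2 * K * \<bar>x\<bar> \<le> K\<^sup>2 + \<bar>x\<bar>\<^sup>2" by (rule sum_squares_bound)
    moreover have "0 \<le> K * \<bar>x\<bar>" by (simp add: K_def)
    ultimately have "K * \<bar>x\<bar> \<le> K\<^sup>2 + x\<^sup>2" by (simp add: mult.assoc)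
    moreover have "x\<^sup>2 \<le> \<kappa> * x\<^sup>2" using assms mult_right_mono[of 1 \<kappa> "x\<^sup>2"] by simp
    moreover have "real k * \<bar>x\<bar> = K * \<bar>x\<bar> - \<bar>x\<bar>" by (simp add: K_def algebra_simps)
    ultimately have "real k * \<bar>x\<bar> + - \<kappa> * x\<^sup>2 \<le> K\<^sup>2 + - \<bar>x\<bar>"
      by linarith
    hence "exp (real k * \<bar>x\<bar>) * exp (- \<kappa> * x\<^sup>2) \<le> exp (K\<^sup>2) * exp (- \<bar>x\<bar>)"
      by (simp only: mult_exp_exp exp_le_cancel_iff)
    hence "C * (exp (real k * \<bar>x\<bar>) * exp (- \<kappa> * x\<^sup>2)) \<le> C * (exp (K\<^sup>2) * exp (- \<bar>x\<bar>))"
      using C(1) by (rule mult_left_mono)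
    moreover have "\<bar>poly p x * exp (- \<kappa> * x\<^sup>2)\<bar> \<le> C * exp (real k * \<bar>x\<bar>) * exp (- \<kappa> * x\<^sup>2)"
      using C(2)[of x] by (simp add: abs_mult)
    ultimately show ?thesis by (simp add: mult_ac)
  qed
  thus ?thesis using C(1) by (intro that[of "C * exp (K\<^sup>2)"]) auto
qed

lemma poly_gaussian_tendsto_0:
  fixes p :: "real poly"
  assumes "\<kappa> \<ge> 1"
  shows "((\<lambda>x. poly p x * exp (- \<kappa> * x\<^sup>2)) \<longlongrightarrow> 0) at_top"
proof -
  obtain C where C: "\<And>x. \<bar>poly p x * exp (- \<kappa> * x\<^sup>2)\<bar> \<le> C * exp (- \<bar>x\<bar>)"
    using poly_gaussian_decay[OF assms] by metis
  have "((\<lambda>x::real. exp (- x)) \<longlongrightarrow> 0) at_top"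
    by (rule filterlim_compose[OF exp_at_bot filterlim_uminus_at_bot_at_top])
  hence "((\<lambda>x. C * exp (- x)) \<longlongrightarrow> 0) at_top" by (rule tendsto_mult_right_zero)
  moreover have "\<forall>\<^sub>F x in at_top. norm (poly p x * exp (- \<kappa> * x\<^sup>2)) \<le> C * exp (- x)"
    using eventually_ge_at_top[of 0] by eventually_elim (use C in \<open>metis abs_of_nonneg real_norm_def\<close>)
  ultimately show ?thesis by (rule Lim_null_comparison[rotated])
qed

lemma nondecreasing_gaussian_poly_nonpos:
  fixes p :: "real poly"
  assumes \<kappa>: "\<kappa> \<ge> 1"
    and mono: "\<And>x. x \<ge> c \<Longrightarrow> poly (pderiv p) x - 2 * \<kappa> * x * poly p x \<ge> 0"
  shows "\<And>x y. c \<le> x \<Longrightarrow> x \<le> y \<Longrightarrow> poly p x * exp (- \<kappa> * x\<^sup>2) \<le> poly p y * exp (- \<kappa> * y\<^sup>2)"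
    and "\<And>x. c \<le> x \<Longrightarrow> poly p x \<le> 0"
proof -
  show *: "poly p x * exp (- \<kappa> * x\<^sup>2) \<le> poly p y * exp (- \<kappa> * y\<^sup>2)" if "c \<le> x" "x \<le> y" for x y
  proof (rule DERIV_nonneg_imp_nondecreasing[OF that(2)])
    fix z assume "x \<le> z" "z \<le> y"
    hence "(poly (pderiv p) z - 2 * \<kappa> * z * poly p z) * exp (- \<kappa> * z\<^sup>2) \<ge> 0"
      using mono[of z] that by simp
    thus "\<exists>d. ((\<lambda>x. poly p x * exp (- \<kappa> * x\<^sup>2)) has_real_derivative d) (at z) \<and> 0 \<le> d"
      using gaussian_poly_deriv by blast
  qed
  show "poly p x \<le> 0" if "c \<le> x" for x
  proof -
    have "\<forall>\<^sub>F y in at_top. poly p x * exp (- \<kappa> * x\<^sup>2) \<le> poly p y * exp (- \<kappa> * y\<^sup>2)"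
      using eventually_ge_at_top[of x] by eventually_elim (use * that in auto)
    hence "poly p x * exp (- \<kappa> * x\<^sup>2) \<le> 0"
      by (intro tendsto_lowerbound[OF poly_gaussian_tendsto_0[OF \<kappa>, of p]]) auto
    thus ?thesis by (simp add: mult_le_0_iff)
  qed
qed

text \<open>The function \<open>u\<close> solves \<open>u'' = 2 * pi * (2 * pi * x\<^sup>2 - (2 * n + 1)) * u\<close>. From the turning point on the
  factor is nonnegative, so \<open>u * u'\<close> is nondecreasing; as it tends to 0 it is nonpositive there, and
  \<open>u\<^sup>2\<close> decreases. A zero of \<open>u\<close> would then force \<open>u\<close> to vanish from there on.\<close>
lemma hermite_decreasing_beyond_turning_point:
  fixes n :: nat and T :: real
  defines "u \<equiv> hermite_window n"
  assumes T: "T \<ge> 0" "2 * pi * T\<^sup>2 \<ge> 2 * real n + 1"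
  shows "\<And>x. T \<le> x \<Longrightarrow> u x > 0" and "\<And>x y. T \<le> x \<Longrightarrow> x \<le> y \<Longrightarrow> u y \<le> u x"
proof -
  define P where "P = hermite_poly n"
  \<comment> \<open>the polynomial part of \<open>u * u'\<close>\<close>
  define R where "R = P * (pderiv P - [:0, 2 * pi:] * P)"
  have pi1: "2 * pi \<ge> 1" using pi_gt3 by linarith
  have R': "poly (pderiv R) x - 2 * (2 * pi) * x * poly R x
      = (poly (pderiv P) x - 2 * pi * x * poly P x)\<^sup>2 + 2 * pi * (2 * pi * x\<^sup>2 - (2 * real n + 1)) * (poly P x)\<^sup>2" for x
  proof -
    have 1: "poly (pderiv R) x = poly (pderiv P) x * (poly (pderiv P) x - 2 * pi * x * poly P x)
       + poly P x * (poly (pderiv (pderiv P)) x - 2 * pi * poly P x - 2 * pi * x * poly (pderiv P) x)"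
      by (simp add: R_def pderiv_mult pderiv_diff pderiv_smult pderiv_pCons algebra_simps)
    have 2: "poly (pderiv (pderiv P)) x = 4 * pi * x * poly (pderiv P) x - 4 * pi * real n * poly P x"
      unfolding P_def by (rule hermite_poly_ode)
    have 3: "poly R x = poly P x * (poly (pderiv P) x - 2 * pi * x * poly P x)"
      by (simp add: R_def)
    show ?thesis unfolding 1 2 3 by (simp add: power2_eq_square algebra_simps)
  qed
  have "poly (pderiv R) x - 2 * (2 * pi) * x * poly R x \<ge> 0" if "x \<ge> T" for x
  proof -
    have "T\<^sup>2 \<le> x\<^sup>2" using that T by (intro power_mono) auto
    hence "2 * pi * T\<^sup>2 \<le> 2 * pi * x\<^sup>2" by (intro mult_left_mono) auto
    hence "0 \<le> 2 * pi * x\<^sup>2 - (2 * real n + 1)" using T by linarith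
    thus ?thesis unfolding R' by (intro add_nonneg_nonneg mult_nonneg_nonneg) auto
  qed
  from nondecreasing_gaussian_poly_nonpos(2)[OF pi1 this]
  have Rneg: "poly R x \<le> 0" if "T \<le> x" for x using that by blast
  have sq: "(u x)\<^sup>2 = poly (P * P) x * exp (- (2 * pi) * x\<^sup>2)" for x
    by (simp add: u_def P_def power2_eq_square mult_ac mult_exp_exp[symmetric] exp_double flip: exp_add)
  have sqmono: "(u y)\<^sup>2 \<le> (u x)\<^sup>2" if "T \<le> x" "x \<le> y" for x y
    unfolding sq
  proof (rule DERIV_nonpos_imp_nonincreasing[OF that(2)])
    fix z assume z: "x \<le> z" "z \<le> y"
    have "(poly (pderiv (P * P)) z - 2 * (2 * pi) * z * poly (P * P) z) = 2 * poly R z"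
      by (simp add: R_def pderiv_mult algebra_simps)
    hence "(poly (pderiv (P * P)) z - 2 * (2 * pi) * z * poly (P * P) z) * exp (- (2 * pi) * z\<^sup>2) \<le> 0"
      using Rneg[of z] z that by (simp add: mult_le_0_iff)
    thus "\<exists>d. ((\<lambda>x. poly (P * P) x * exp (- (2 * pi) * x\<^sup>2)) has_real_derivative d) (at z) \<and> d \<le> 0"
      using gaussian_poly_deriv by blast
  qed
  obtain \<delta> X where X: "\<delta> > 0" "\<And>x. x \<ge> X \<Longrightarrow> poly (hermite_poly n) x \<ge> \<delta>"
    using hermite_poly_eventually_pos by metis
  have Xpos: "u x > 0" if "x \<ge> X" for x
    using X that by (force simp: u_def)
  show pos: "u x > 0" if "T \<le> x" for x
  proof (rule ccontr)
    assume neg: "\<not> u x > 0"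
    obtain w where w: "w \<ge> x" "w \<ge> X" using max.cobounded1 max.cobounded2 by blast
    have "continuous_on {x..w} u" unfolding u_def by (intro continuous_intros)
    then obtain z where z: "z \<ge> x" "u z = 0"
      using IVT'[of u x 0 w] neg Xpos[OF w(2)] w(1) by (auto simp: not_less)
    have "(u (max z X))\<^sup>2 \<le> (u z)\<^sup>2" using z that by (intro sqmono) auto
    thus False using z(2) Xpos[of "max z X"] by simp
  qed
  show "u y \<le> u x" if "T \<le> x" "x \<le> y" for x y
    using sqmono[OF that] pos[of x] that by (meson less_imp_le power2_le_imp_le)
qed

text \<open>This amounts to Laguerre's lower bound for the largest zero, obtained by Sturm comparison instead
  of through reality of all zeros. The comparison polynomial is \<open>p = (x - c) * (x + c) ^ (n - 1)\<close>:
  its remaining zeros sit at \<open>- c\<close>, as far to the left as the symmetry of the zeros of a Hermite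
  polynomial permits. With \<open>L p = p'' - 4 * pi * x * p' + 4 * pi * n * p\<close>, the operator that annihilates the
  Hermite polynomial \<open>P\<close>, the bound on \<open>c\<close> makes \<open>L p\<close> nonnegative on \<open>[c, \<infinity>)\<close>. If \<open>P\<close> were
  nonnegative there too, the weighted Wronskian of \<open>P\<close> and \<open>p\<close> would be nondecreasing, nonnegative at
  \<open>c\<close> and tend to 0, hence vanish, although its derivative is eventually positive.\<close>
lemma hermite_poly_negative_beyond:
  fixes n :: nat and c :: real
  assumes n: "n \<ge> 3" and c: "c > 0" "4 * pi * c\<^sup>2 \<le> real n - 1"
  shows "\<exists>x\<ge>c. poly (hermite_poly n) x < 0"
proof (rule ccontr)
  assume "\<not> ?thesis"
  hence nonneg: "poly (hermite_poly n) x \<ge> 0" if "x \<ge> c" for x using that by force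
  obtain k where k: "n = k + 3" using n by (metis add.commute le_Suc_ex)
  define P where "P = hermite_poly n"
  define p where "p = [:- c, 1:] * [:c, 1:] ^ (k + 2)"
  define W where "W = P * pderiv p - pderiv P * p"
  define Lp where "Lp = (\<lambda>x. (x + c) ^ k * (4 * c * (real n - 1 - 4 * pi * c\<^sup>2)
       + (x - c) * (real n * (real n - 1) + 8 * pi * c\<^sup>2 * (real n - 3)) + 4 * pi * c * (real n - 2) * (x - c)\<^sup>2))"
  have pi1: "2 * pi \<ge> 1" using pi_gt3 by linarith
  have p0: "poly p x = (x - c) * (x + c) ^ (k + 2)" for x
    by (simp add: p_def algebra_simps)
  have pw: "pderiv ([:c, 1:] ^ Suc j) = smult (real j + 1) ([:c, 1:] ^ j)" for j
    by (simp add: pderiv_power_Suc pderiv_pCons add.commute del: power_Suc)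
  have p1: "pderiv p = [:c, 1:] ^ Suc (Suc k) + smult (real k + 2) ([:- c, 1:] * [:c, 1:] ^ Suc k)"
    unfolding p_def add_2_eq_Suc' pderiv_mult pw
    by (simp add: pderiv_pCons add.commute del: power_Suc mult_pCons_left)
  have p1': "poly (pderiv p) x = (x + c) ^ Suc (Suc k) + (real k + 2) * ((x - c) * (x + c) ^ Suc k)" for x
    unfolding p1 by (simp add: algebra_simps)
  have p2: "poly (pderiv (pderiv p)) x = 2 * (real k + 2) * (x + c) ^ Suc k
      + (real k + 2) * (real k + 1) * ((x - c) * (x + c) ^ k)" for x
    unfolding p1 pderiv_add pderiv_smult pderiv_mult pw
    by (simp add: pderiv_pCons algebra_simps)
  have ode: "poly (pderiv (pderiv p)) x - 4 * pi * x * poly (pderiv p) x + 4 * pi * real n * poly p x = Lp x" for x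
    unfolding p2 p0 p1' Lp_def k by (simp add: algebra_simps power2_eq_square)
  have W': "poly (pderiv W) x - 2 * (2 * pi) * x * poly W x = poly P x * Lp x" for x
  proof -
    have 1: "poly (pderiv W) x = poly P x * poly (pderiv (pderiv p)) x - poly (pderiv (pderiv P)) x * poly p x"
      by (simp add: W_def pderiv_mult pderiv_diff algebra_simps)
    have 2: "poly (pderiv (pderiv P)) x = 4 * pi * x * poly (pderiv P) x - 4 * pi * real n * poly P x"
      unfolding P_def by (rule hermite_poly_ode)
    have 3: "poly W x = poly P x * poly (pderiv p) x - poly (pderiv P) x * poly p x"
      by (simp add: W_def)
    show ?thesis unfolding 1 2 3 ode[symmetric] by (simp add: algebra_simps)
  qed
  have Lp_ge: "Lp x \<ge> (x + c) ^ k * ((x - c) * (real n * (real n - 1)))" if "x \<ge> c" for x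
  proof -
    have "0 \<le> 4 * c * (real n - 1 - 4 * pi * c\<^sup>2)" using c by simp
    moreover have "0 \<le> (x - c) * (8 * pi * c\<^sup>2 * (real n - 3))" using c n that by simp
    moreover have "0 \<le> 4 * pi * c * (real n - 2) * (x - c)\<^sup>2" using c n by simp
    ultimately have "(x - c) * (real n * (real n - 1)) \<le> 4 * c * (real n - 1 - 4 * pi * c\<^sup>2)
       + ((x - c) * (real n * (real n - 1)) + (x - c) * (8 * pi * c\<^sup>2 * (real n - 3)))
       + 4 * pi * c * (real n - 2) * (x - c)\<^sup>2" by linarith
    thus ?thesis unfolding Lp_def ring_distribs(1)[of "x - c", symmetric]
      using c that by (intro mult_left_mono) auto
  qed
  have Lp_nonneg: "Lp x \<ge> 0" if "x \<ge> c" for x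
  proof -
    have "0 \<le> (x + c) ^ k * ((x - c) * (real n * (real n - 1)))" using c n that by simp
    thus ?thesis using Lp_ge[OF that] by linarith
  qed
  have incr: "poly (pderiv W) x - 2 * (2 * pi) * x * poly W x \<ge> 0" if "x \<ge> c" for x
    unfolding W' using nonneg[OF that] Lp_nonneg[OF that] by (simp add: P_def)
  have Wmono: "poly W x * exp (- (2 * pi) * x\<^sup>2) \<le> poly W y * exp (- (2 * pi) * y\<^sup>2)"
    if "c \<le> x" "x \<le> y" for x y
    using nondecreasing_gaussian_poly_nonpos(1)[OF pi1, of c W x y] incr that by blast
  have Wneg: "poly W x \<le> 0" if "c \<le> x" for x
    using nondecreasing_gaussian_poly_nonpos(2)[OF pi1, of c W x] incr that by blast
  have Wc: "poly W c \<ge> 0"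
  proof -
    have "poly W c = poly P c * (2 * c) ^ (k + 2)"
      unfolding W_def by (simp add: p0 p1')
    thus ?thesis using nonneg[of c] c by (simp add: P_def)
  qed
  have W0: "poly W x * exp (- (2 * pi) * x\<^sup>2) = 0" if "x \<ge> c" for x
  proof -
    have "0 \<le> poly W c * exp (- (2 * pi) * c\<^sup>2)" using Wc by simp
    also have "\<dots> \<le> poly W x * exp (- (2 * pi) * x\<^sup>2)" using that by (intro Wmono) auto
    finally show ?thesis using Wneg[OF that] by (simp add: zero_le_mult_iff)
  qed
  obtain \<delta> X where X: "\<delta> > 0" "\<And>x. x \<ge> X \<Longrightarrow> poly P x \<ge> \<delta>"
    using hermite_poly_eventually_pos unfolding P_def by metis
  define y where "y = max X (c + 1)"
  have y: "y \<ge> X" "y > c" by (auto simp: y_def)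
  have "0 < (y + c) ^ k * ((y - c) * (real n * (real n - 1)))" using c n y by simp
  hence "Lp y > 0" using Lp_ge[of y] y by linarith
  hence "(poly (pderiv W) y - 2 * (2 * pi) * y * poly W y) * exp (- (2 * pi) * y\<^sup>2) > 0"
    unfolding W' using X(2)[OF y(1)] X(1) by simp
  from DERIV_pos_inc_right[OF gaussian_poly_deriv this]
  obtain d where "d > 0" "\<And>h. 0 < h \<Longrightarrow> h < d \<Longrightarrow>
      poly W y * exp (- (2 * pi) * y\<^sup>2) < poly W (y + h) * exp (- (2 * pi) * (y + h)\<^sup>2)"
    by blast
  from this(2)[of "d / 2"] this(1) show False
    using W0[of y] W0[of "y + d / 2"] y by simp
qed

section \<open>Zeros of lacunary sums of Hermite functions\<close>

lemma has_sum_int_symmetric_limit: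
  fixes f :: "int \<Rightarrow> real"
  assumes "(f has_sum S) UNIV"
  shows "(\<lambda>M. f 0 + (\<Sum>l=1..M. f (int l) + f (- int l))) \<longlonglongrightarrow> S"
proof -
  have eq: "f 0 + (\<Sum>l=1..M. f (int l) + f (- int l)) = sum f {- int M..int M}" for M
  proof (induction M)
    case (Suc M)
    have "{- int (Suc M)..int (Suc M)} = insert (int (Suc M)) (insert (- int (Suc M)) {- int M..int M})"
      by auto
    thus ?case using Suc by simp
  qed simp
  have "filterlim (\<lambda>M. {- int M..int M}) (finite_subsets_at_top UNIV) sequentially"
    unfolding filterlim_finite_subsets_at_top
  proof safe
    fix X :: "int set" assume X: "finite X"
    define N where "N = nat (Max (insert 0 (abs ` X)))"
    have "\<bar>x\<bar> \<le> int N" if "x \<in> X" for x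
      using X that by (auto simp: N_def intro!: Max_ge)
    hence "X \<subseteq> {- int M..int M}" if "M \<ge> N" for M
      using that by force
    thus "\<forall>\<^sub>F M in sequentially. finite {- int M..int M} \<and> X \<subseteq> {- int M..int M} \<and> {- int M..int M} \<subseteq> UNIV"
      unfolding eventually_sequentially by (intro exI[of _ N]) auto
  qed
  from filterlim_compose[OF assms[unfolded has_sum_def] this] show ?thesis
    unfolding eq .
qed

definition alt_sign :: "int \<Rightarrow> real" where "alt_sign l = (if even l then 1 else - 1)"

text \<open>By oddness the terms for \<open>l\<close> and \<open>- l\<close> combine to \<open>v ((4 * l + 1) * a) - v ((4 * l - 1) * a)\<close>, so the
  series is the alternating sum \<open>v a - v (3 * a) + v (5 * a) - ...\<close> (the character modulo 4), which
  from its second term on is of Leibniz type.\<close>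
lemma odd_lacunary_sum_bounds:
  fixes v :: "real \<Rightarrow> real"
  assumes odd: "\<And>x. v (- x) = - v x" and a: "a > 0"
    and pos: "\<And>x. 3 * a \<le> x \<Longrightarrow> v x \<ge> 0" and dec: "\<And>x y. 3 * a \<le> x \<Longrightarrow> x \<le> y \<Longrightarrow> v y \<le> v x"
    and S: "((\<lambda>l. v (a * of_int (4 * l + 1))) has_sum S) UNIV"
  shows "S \<le> v a" and "v a - 2 * v (3 * a) \<le> S"
proof -
  define D where "D = (\<lambda>M. \<Sum>l=1..M. v (a * of_int (4 * int l + 1)) + v (a * of_int (4 * (- int l) + 1)))"
  have lim: "(\<lambda>M. v a + D M) \<longlonglongrightarrow> S"
    using has_sum_int_symmetric_limit[OF S] by (simp add: D_def)
  have refl: "v (a * of_int (4 * (- int l) + 1)) = - v (a * (4 * real l - 1))" for l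
    using odd[of "a * (4 * real l - 1)"] by (simp add: algebra_simps)
  have le: "v (a * y) \<le> v (a * x)" if "3 \<le> x" "x \<le> y" for x y
    using that a dec[of "a * x" "a * y"] by (simp add: mult.commute)
  have "D M \<le> 0 \<and> v (a * (4 * real M + 1)) - v (3 * a) \<le> D M" if "M \<ge> 1" for M
    using that
  proof (induction M rule: dec_induct)
    case base
    show ?case using le[of 3 5] odd[of "a * 3"] by (simp add: D_def mult.commute)
  next
    case (step M)
    have "D (Suc M) = D M + v (a * (4 * real M + 5)) - v (a * (4 * real M + 3))"
      using refl[of "Suc M"] by (simp add: D_def algebra_simps)
    moreover have "v (a * (4 * real M + 5)) \<le> v (a * (4 * real M + 3))"
      "v (a * (4 * real M + 3)) \<le> v (a * (4 * real M + 1))"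
      using step(1) by (auto intro!: le)
    moreover have "4 * real (Suc M) + 1 = 4 * real M + 5" by simp
    ultimately show ?case using step.IH by (simp only:) linarith
  qed
  moreover have "v (a * (4 * real M + 1)) \<ge> 0" if "M \<ge> 1" for M
  proof (rule pos)
    have "3 \<le> 4 * real M + 1" using that by simp
    thus "3 * a \<le> a * (4 * real M + 1)" using a mult_left_mono[of 3 "4 * real M + 1" a] by simp
  qed
  moreover have "v (3 * a) \<ge> 0" by (rule pos) simp
  ultimately have b: "v a + D M \<le> v a" "v a - 2 * v (3 * a) \<le> v a + D M" if "M \<ge> 1" for M
    using that by fastforce+
  show "S \<le> v a"
    by (rule tendsto_upperbound[OF lim]) (use b(1) in \<open>auto simp: eventually_sequentially\<close>)
  show "v a - 2 * v (3 * a) \<le> S"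
    by (rule tendsto_lowerbound[OF lim]) (use b(2) in \<open>auto simp: eventually_sequentially\<close>)
qed

text \<open>Here the series is \<open>v a - v (5 * a) - v (7 * a) + v (11 * a) + v (13 * a) - ...\<close>, with the signs of the even
  character modulo 12; the pairs from \<open>l\<close> and \<open>- l\<close> form an alternating series of Leibniz type,
  whose first pair is at most \<open>2 * v (3 * a)\<close>.\<close>
lemma even_lacunary_sum_bounds:
  fixes v :: "real \<Rightarrow> real"
  assumes even: "\<And>x. v (- x) = v x" and a: "a > 0"
    and pos: "\<And>x. 3 * a \<le> x \<Longrightarrow> v x \<ge> 0" and dec: "\<And>x y. 3 * a \<le> x \<Longrightarrow> x \<le> y \<Longrightarrow> v y \<le> v x"
    and S: "((\<lambda>l. alt_sign l * v (a * of_int (6 * l + 1))) has_sum S) UNIV"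
  shows "S \<le> v a" and "v a - 2 * v (3 * a) \<le> S"
proof -
  define b where "b = (\<lambda>l::nat. v (a * (6 * real l + 1)) + v (a * (6 * real l - 1)))"
  define D where "D = (\<lambda>M. \<Sum>l=1..M. (- 1) ^ l * b l)"
  have refl: "v (a * of_int (6 * (- int l) + 1)) = v (a * (6 * real l - 1))" for l
    using even[of "a * (6 * real l - 1)"] by (simp add: algebra_simps)
  have sgn: "alt_sign (int l) = (- 1) ^ l" "alt_sign (- int l) = (- 1) ^ l" for l
    by (auto simp: alt_sign_def)
  have pair: "alt_sign (int l) * v (a * of_int (6 * int l + 1)) + alt_sign (- int l) * v (a * of_int (6 * (- int l) + 1))
      = (- 1) ^ l * b l" for l
    unfolding refl sgn b_def by (simp add: ring_distribs)
  have lim: "(\<lambda>M. v a + D M) \<longlonglongrightarrow> S"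
    using has_sum_int_symmetric_limit[OF S] unfolding pair D_def by (simp add: alt_sign_def)
  have le: "v (a * y) \<le> v (a * x)" if "3 \<le> x" "x \<le> y" for x y
    using that a dec[of "a * x" "a * y"] by (simp add: mult.commute)
  have b_dec: "b (Suc l) \<le> b l" if "l \<ge> 1" for l
    unfolding b_def using that by (intro add_mono le) auto
  have nonneg: "v (a * x) \<ge> 0" if "x \<ge> 3" for x
    using that a pos[of "a * x"] by (simp add: mult.commute)
  have b_nonneg: "b l \<ge> 0" if "l \<ge> 1" for l
    unfolding b_def using that by (intro add_nonneg_nonneg nonneg) auto
  have "- b 1 \<le> D M \<and> D M \<le> 0 \<and> (even M \<longrightarrow> - b 1 + b M \<le> D M) \<and> (odd M \<longrightarrow> D M \<le> - b M)"
    if "M \<ge> 1" for M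
    using that
  proof (induction M rule: dec_induct)
    case base
    show ?case using b_nonneg[of 1] by (simp add: D_def)
  next
    case (step M)
    have "D (Suc M) = D M + (- 1) ^ Suc M * b (Suc M)"
      by (simp add: D_def)
    thus ?case using step b_dec[OF step(1)] b_nonneg[of "Suc M"]
      by (cases "even M") auto
  qed
  moreover have "b 1 \<le> 2 * v (3 * a)"
    using le[of 3 7] le[of 3 5] by (simp add: b_def mult.commute)
  ultimately have bd: "v a + D M \<le> v a" "v a - 2 * v (3 * a) \<le> v a + D M" if "M \<ge> 1" for M
    using that by fastforce+
  show "S \<le> v a"
    by (rule tendsto_upperbound[OF lim]) (use bd(1) in \<open>auto simp: eventually_sequentially\<close>)
  show "v a - 2 * v (3 * a) \<le> S"
    by (rule tendsto_lowerbound[OF lim]) (use bd(2) in \<open>auto simp: eventually_sequentially\<close>)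
qed

definition lacunary_sum :: "nat \<Rightarrow> (int \<Rightarrow> real) \<Rightarrow> int \<Rightarrow> real \<Rightarrow> int \<Rightarrow> real" where
  "lacunary_sum n c Q a s =
     (\<Sum>\<^sub>\<infinity>l. c l * hermite_window n (a * of_int (Q * l + s)))"

lemma hermite_decay:
  obtains C where "C \<ge> 0" "\<And>x. \<bar>hermite_window n x\<bar> \<le> C * exp (- \<bar>x\<bar>)"
  using poly_gaussian_decay[of pi "hermite_poly n"] pi_gt3 by (metis less_imp_le less_trans one_less_numeral_iff semiring_norm(77))

lemma lacunary_sum_has_sum:
  assumes a: "a > 0" and Q: "Q > 0" and c: "\<And>l. \<bar>c l\<bar> = 1"
  shows "((\<lambda>l. c l * hermite_window n (a * of_int (Q * l + s)))
            has_sum lacunary_sum n c Q a s) UNIV"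
proof -
  obtain C where C: "C \<ge> 0" "\<And>x. \<bar>hermite_window n x\<bar> \<le> C * exp (- \<bar>x\<bar>)"
    using hermite_decay[of n] by metis
  show ?thesis unfolding lacunary_sum_def
  proof (intro has_sum_infsum exp_decay_summable)
    show "a * of_int Q > 0" using a Q by simp
    fix l
    show "\<bar>c l * hermite_window n (a * of_int (Q * l + s))\<bar>
        \<le> C * exp (- \<bar>a * of_int Q * of_int l - (- a * of_int s)\<bar>)"
      using C(2)[of "a * of_int (Q * l + s)"] c[of l] by (simp add: abs_mult algebra_simps)
  qed
qed

lemma continuous_on_lacunary_sum:
  assumes a0: "a0 > 0" and Q: "Q > 0" and c: "\<And>l. \<bar>c l\<bar> = 1"
  shows "continuous_on {a0..} (\<lambda>a. lacunary_sum n c Q a s)"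
proof -
  obtain C where C: "C \<ge> 0" "\<And>x. \<bar>hermite_window n x\<bar> \<le> C * exp (- \<bar>x\<bar>)"
    using hermite_decay[of n] by metis
  define M where "M = (\<lambda>l. C * exp (- \<bar>a0 * of_int Q * of_int l - (- a0 * of_int s)\<bar>))"
  have M: "M summable_on UNIV"
    unfolding M_def
    by (rule exp_decay_summable[where a = "a0 * of_int Q" and s = "- a0 * of_int s" and C = C]) (use a0 Q C(1) in auto)
  show ?thesis
    unfolding lacunary_sum_def
  proof (rule continuous_on_infsum_M_test[OF _ M])
    fix l a assume a: "a \<in> {a0..}"
    have "\<bar>c l * hermite_window n (a * of_int (Q * l + s))\<bar>
        \<le> C * exp (- \<bar>a * of_int (Q * l + s)\<bar>)"
      using C(2)[of "a * of_int (Q * l + s)"] c[of l] by (simp add: abs_mult)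
    also have "\<dots> \<le> C * exp (- \<bar>a0 * of_int (Q * l + s)\<bar>)"
      using a a0 C(1) by (intro mult_left_mono) (auto simp: abs_mult intro!: mult_right_mono)
    also have "\<dots> = M l" by (simp add: M_def algebra_simps)
    finally show "\<bar>c l * hermite_window n (a * of_int (Q * l + s))\<bar> \<le> M l" .
  qed (intro continuous_intros)
qed

text \<open>The sum is a continuous function of \<open>a\<close>, so a sign change suffices. It is negative where the first
  term is negative and all others lie beyond the turning point \<open>3 * T\<close>; it is positive for large \<open>a\<close>,
  where the first term dominates.\<close>
lemma lacunary_sum_zero:
  fixes n :: nat
  defines "u \<equiv> hermite_window n"
  assumes n: "n \<ge> 3" and Q: "Q > 0" and c: "\<And>l. \<bar>c l\<bar> = 1"
    and bounds: "\<And>a. a > 0 \<Longrightarrow> 2 * pi * (3 * a)\<^sup>2 \<ge> 2 * real n + 1 \<Longrightarrow>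
        lacunary_sum n c Q a 1 \<le> u a \<and> u a - 2 * u (3 * a) \<le> lacunary_sum n c Q a 1"
  shows "\<exists>a>0. lacunary_sum n c Q a 1 = 0"
proof -
  define T where "T = sqrt ((2 * real n + 1) / (18 * pi))"
  have T: "T > 0" "18 * pi * T\<^sup>2 = 2 * real n + 1"
    by (auto simp: T_def)
  \<comment> \<open>a third of the turning point still lies below the largest zero\<close>
  have "4 * pi * T\<^sup>2 \<le> real n - 1" using T(2) n by simp
  then obtain a0 where a0: "a0 \<ge> T" "poly (hermite_poly n) a0 < 0"
    using hermite_poly_negative_beyond[OF n T(1)] by blast
  have beyond: "2 * pi * (3 * a)\<^sup>2 \<ge> 2 * real n + 1" if "a \<ge> T" for a
  proof -
    have "T\<^sup>2 \<le> a\<^sup>2" using that T by (intro power_mono) auto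
    thus ?thesis using T(2) by (simp add: power_mult_distrib flip: T(2))
  qed
  have a0pos: "a0 > 0" using a0 T by linarith
  have neg: "lacunary_sum n c Q a0 1 < 0"
    using bounds[OF a0pos beyond[OF a0(1)]] a0(2) by (smt (verit) u_def exp_gt_zero mult_neg_pos)
  obtain \<delta> X where X: "\<delta> > 0" "\<And>x. x \<ge> X \<Longrightarrow> poly (hermite_poly n) x \<ge> \<delta>"
    using hermite_poly_eventually_pos by metis
  \<comment> \<open>\<open>8 / 9 * (3 * a)\<^sup>2 = (3 * a)\<^sup>2 - a\<^sup>2\<close> compares the two Gaussian factors\<close>
  have "8 / 9 * pi \<ge> 1" using pi_gt3 by simp
  from poly_gaussian_tendsto_0[OF this, of "hermite_poly n"]
  have "\<forall>\<^sub>F x in at_top. poly (hermite_poly n) x * exp (- (8 / 9 * pi) * x\<^sup>2) < \<delta> / 2"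
    using X(1) by (intro order_tendstoD(2)) auto
  then obtain Y where Y: "\<And>x. x \<ge> Y \<Longrightarrow> poly (hermite_poly n) x * exp (- (8 / 9 * pi) * x\<^sup>2) < \<delta> / 2"
    unfolding eventually_at_top_linorder by blast
  define a1 where "a1 = max a0 (max X Y)"
  have a1: "a1 \<ge> a0" "a1 \<ge> X" "3 * a1 \<ge> Y" "a1 > 0" using a0pos by (auto simp: a1_def)
  have "2 * u (3 * a1) < u a1"
  proof -
    have "2 * (poly (hermite_poly n) (3 * a1) * exp (- (8 / 9 * pi) * (3 * a1)\<^sup>2)) < poly (hermite_poly n) a1"
      using Y[OF a1(3)] X(2)[OF a1(2)] by linarith
    hence "2 * (poly (hermite_poly n) (3 * a1) * exp (- (8 / 9 * pi) * (3 * a1)\<^sup>2)) * exp (- pi * a1\<^sup>2) < u a1"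
      unfolding u_def by (intro mult_strict_right_mono) auto
    moreover have "exp (- (8 / 9 * pi) * (3 * a1)\<^sup>2) * exp (- pi * a1\<^sup>2) = exp (- pi * (3 * a1)\<^sup>2)"
      by (simp add: mult_exp_exp power_mult_distrib)
    ultimately show ?thesis unfolding u_def by (simp only: mult.assoc)
  qed
  hence pos: "lacunary_sum n c Q a1 1 > 0"
    using bounds[OF a1(4) beyond] a1(1) a0(1) by auto
  have "continuous_on {a0..a1} (\<lambda>a. lacunary_sum n c Q a 1)"
    by (rule continuous_on_subset[OF continuous_on_lacunary_sum[OF a0pos Q c]]) auto
  then obtain a where "a0 \<le> a" "lacunary_sum n c Q a 1 = 0"
    using IVT'[of "\<lambda>a. lacunary_sum n c Q a 1" a0 0 a1] neg pos a1(1) by auto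
  thus ?thesis using a0pos by (intro exI[of _ a]) auto
qed

lemma lacunary_sum_shift:
  assumes a: "a > 0" and Q: "Q > 0" and c: "\<And>l. \<bar>c l\<bar> = 1" and mult: "\<And>l j. c (l + j) = c l * c j"
  shows "lacunary_sum n c Q a (s + Q * j) = c j * lacunary_sum n c Q a s"
proof -
  define f where "f = (\<lambda>s l. c l * hermite_window n (a * of_int (Q * l + s)))"
  have sq: "c j * c j = 1" using c[of j] by (metis abs_mult_self_eq mult_1_left)
  have "((\<lambda>l. c j * f s l) has_sum (c j * lacunary_sum n c Q a s)) UNIV"
    unfolding f_def by (intro has_sum_cmult_right lacunary_sum_has_sum a Q c)
  moreover have "((\<lambda>l. f (s + Q * j) l) has_sum (c j * lacunary_sum n c Q a s)) UNIV
      \<longleftrightarrow> ((\<lambda>l. c j * f s l) has_sum (c j * lacunary_sum n c Q a s)) UNIV"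
  proof (rule has_sum_reindex_bij_witness[of _ "\<lambda>l. l - j" "\<lambda>l. l + j"])
    fix l
    have "c j * c (l + j) = c l" using sq mult[of l j] by simp
    moreover have "Q * (l + j) + s = Q * l + (s + Q * j)" by (simp add: algebra_simps)
    ultimately show "c j * f s (l + j) = f (s + Q * j) l"
      unfolding f_def by (simp only: mult.assoc[symmetric])
  qed auto
  ultimately have "(f (s + Q * j) has_sum (c j * lacunary_sum n c Q a s)) UNIV" by simp
  thus ?thesis
    unfolding lacunary_sum_def f_def by (rule infsumI)
qed

lemma lacunary_sum_uminus:
  assumes a: "a > 0" and Q: "Q > 0" and c: "\<And>l. \<bar>c l\<bar> = 1" and even: "\<And>l. c (- l) = c l"
  shows "lacunary_sum n c Q a (- s) = (- 1) ^ n * lacunary_sum n c Q a s"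
proof -
  define f where "f = (\<lambda>s l. c l * hermite_window n (a * of_int (Q * l + s)))"
  have "((\<lambda>l. (- 1) ^ n * f s l) has_sum ((- 1) ^ n * lacunary_sum n c Q a s)) UNIV"
    unfolding f_def by (intro has_sum_cmult_right lacunary_sum_has_sum a Q c)
  moreover have "((\<lambda>l. f (- s) l) has_sum ((- 1) ^ n * lacunary_sum n c Q a s)) UNIV
      \<longleftrightarrow> ((\<lambda>l. (- 1) ^ n * f s l) has_sum ((- 1) ^ n * lacunary_sum n c Q a s)) UNIV"
  proof (rule has_sum_reindex_bij_witness[of _ "uminus" "uminus"])
    fix l
    define y where "y = a * of_int (Q * l + - s)"
    have y: "a * of_int (Q * - l + s) = - y" by (simp add: y_def algebra_simps)
    have "(- 1) ^ n * ((- 1) ^ n * z) = z" for z :: real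
      by (simp add: mult.assoc[symmetric] flip: power_mult_distrib)
    thus "(- 1) ^ n * f s (- l) = f (- s) l"
      unfolding f_def y y_def[symmetric] hermite_poly_uminus even by (simp add: mult_ac)
  qed auto
  ultimately have "(f (- s) has_sum ((- 1) ^ n * lacunary_sum n c Q a s)) UNIV" by simp
  thus ?thesis
    unfolding lacunary_sum_def f_def by (rule infsumI)
qed

lemma alt_sign: "\<bar>alt_sign l\<bar> = 1" "alt_sign (l + j) = alt_sign l * alt_sign j" "alt_sign (- l) = alt_sign l"
  by (auto simp: alt_sign_def)

text \<open>The sums are odd in \<open>s\<close> and have period 4, so those for even \<open>s\<close> vanish by symmetry and the remaining
  two are opposite: one equation in the one parameter \<open>a\<close>.\<close>
lemma all_odd_lacunary_sums_vanish:
  assumes "odd n" "n \<ge> 3"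
  shows "\<exists>a>0. \<forall>s. lacunary_sum n (\<lambda>_. 1) 4 a s = 0"
proof -
  define u where "u = hermite_window n"
  have oddu: "u (- x) = - u x" for x using assms by (simp add: u_def hermite_poly_uminus)
  have "lacunary_sum n (\<lambda>_. 1) 4 a 1 \<le> u a \<and> u a - 2 * u (3 * a) \<le> lacunary_sum n (\<lambda>_. 1) 4 a 1"
    if a: "a > 0" "2 * pi * (3 * a)\<^sup>2 \<ge> 2 * real n + 1" for a
  proof -
    have S: "((\<lambda>l. u (a * of_int (4 * l + 1))) has_sum lacunary_sum n (\<lambda>_. 1) 4 a 1) UNIV"
      using lacunary_sum_has_sum[of a 4 "\<lambda>_. 1" n 1] a by (simp add: u_def)
    have a3: "0 \<le> 3 * a" using a by simp
    have pos: "u x \<ge> 0" if "3 * a \<le> x" for x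
      using hermite_decreasing_beyond_turning_point(1)[OF a3 a(2) that] unfolding u_def by simp
    have dec: "u y \<le> u x" if "3 * a \<le> x" "x \<le> y" for x y
      using hermite_decreasing_beyond_turning_point(2)[OF a3 a(2) that] unfolding u_def .
    show ?thesis
      using odd_lacunary_sum_bounds[OF oddu a(1) pos dec S] by blast
  qed
  then obtain a where a: "a > 0" "lacunary_sum n (\<lambda>_. 1) 4 a 1 = 0"
    using lacunary_sum_zero[of n 4 "\<lambda>_. 1"] assms unfolding u_def by auto
  define V where "V = lacunary_sum n (\<lambda>_. 1) 4 a"
  have shift: "V (s + 4 * j) = V s" for s j
    using lacunary_sum_shift[of a 4 "\<lambda>_. 1" n s j] a by (simp add: V_def)
  have neg: "V (- s) = - V s" for s
    using lacunary_sum_uminus[of a 4 "\<lambda>_. 1" n s] a assms by (simp add: V_def)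
  have "V s = 0" for s
  proof -
    have s: "V s = V (s mod 4)" using shift[of "s mod 4" "s div 4"] by simp
    have "s mod 4 \<in> {0, 1, 2, 3}" by auto
    moreover have "V 0 = 0" using neg[of 0] by simp
    moreover have "V 2 = 0" using neg[of 2] shift[of "- 2" 1] by simp
    moreover have "V 1 = 0" using a by (simp add: V_def)
    moreover have "V 3 = 0" using neg[of 1] shift[of "- 1" 1] \<open>V 1 = 0\<close> by simp
    ultimately show ?thesis using s by auto
  qed
  thus ?thesis using a(1) unfolding V_def by blast
qed

text \<open>The sums are even in \<open>s\<close> and change sign under \<open>s + 6\<close>; hence the sum for \<open>s = 3\<close> vanishes by symmetry
  and those for 1 and 5 are opposite, which leaves one equation in \<open>a\<close>.\<close>
lemma all_even_lacunary_sums_vanish: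
  assumes "even n" "n \<ge> 3"
  shows "\<exists>a>0. \<forall>s. odd s \<longrightarrow> lacunary_sum n alt_sign 6 a s = 0"
proof -
  define u where "u = hermite_window n"
  have evenu: "u (- x) = u x" for x using assms by (simp add: u_def hermite_poly_uminus)
  have "lacunary_sum n alt_sign 6 a 1 \<le> u a \<and> u a - 2 * u (3 * a) \<le> lacunary_sum n alt_sign 6 a 1"
    if a: "a > 0" "2 * pi * (3 * a)\<^sup>2 \<ge> 2 * real n + 1" for a
  proof -
    have S: "((\<lambda>l. alt_sign l * u (a * of_int (6 * l + 1))) has_sum lacunary_sum n alt_sign 6 a 1) UNIV"
      using lacunary_sum_has_sum[of a 6 alt_sign n 1] a alt_sign by (simp add: u_def)
    have a3: "0 \<le> 3 * a" using a by simp
    have pos: "u x \<ge> 0" if "3 * a \<le> x" for x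
      using hermite_decreasing_beyond_turning_point(1)[OF a3 a(2) that] unfolding u_def by simp
    have dec: "u y \<le> u x" if "3 * a \<le> x" "x \<le> y" for x y
      using hermite_decreasing_beyond_turning_point(2)[OF a3 a(2) that] unfolding u_def .
    show ?thesis
      using even_lacunary_sum_bounds[OF evenu a(1) pos dec S] by blast
  qed
  then obtain a where a: "a > 0" "lacunary_sum n alt_sign 6 a 1 = 0"
    using lacunary_sum_zero[of n 6 alt_sign] assms alt_sign unfolding u_def by auto
  define V where "V = lacunary_sum n alt_sign 6 a"
  have shift: "V (s + 6 * j) = alt_sign j * V s" for s j
    using lacunary_sum_shift[of a 6 alt_sign n s j] a alt_sign by (simp add: V_def)
  have neg: "V (- s) = V s" for s
    using lacunary_sum_uminus[of a 6 alt_sign n s] a assms alt_sign by (simp add: V_def)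
  have alt1: "alt_sign 1 = - 1" by (simp add: alt_sign_def)
  have "V s = 0" if "odd s" for s
  proof -
    have s: "V s = alt_sign (s div 6) * V (s mod 6)" using shift[of "s mod 6" "s div 6"] by simp
    have "s mod 6 \<in> {1, 3, 5}" using that by auto presburger
    moreover have "V 3 = 0" using neg[of 3] shift[of "- 3" 1] alt1 by simp
    moreover have "V 1 = 0" using a by (simp add: V_def)
    moreover have "V 5 = 0" using neg[of 1] shift[of "- 1" 1] \<open>V 1 = 0\<close> by simp
    ultimately show ?thesis using s by auto
  qed
  thus ?thesis using a(1) unfolding V_def by blast
qed

text \<open>The shift parameter is \<open>p * a\<close>; with \<open>p = 2\<close> and odd \<open>r\<close> the sample points are the odd multiples
  of \<open>a\<close>, as the even case requires.\<close>
lemma not_frame_if_lacunary_sums_vanish: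
  assumes a: "a > 0" and p: "p > 0" and q: "q > 0" and c: "\<And>l. \<bar>c l\<bar> = 1"
    and zero: "\<And>k. lacunary_sum n c (p * q) a (r - p * k) = 0"
  shows "\<not> L2_frame (gabor_system (\<lambda>x. complex_of_real (hermite_function n x))
            (of_int p * a) (1 / (of_int p * a * of_int q)))"
proof -
  define K where "K = hermite_const n powr (- 1 / 2)"
  have h: "hermite_function n = (\<lambda>x. K * hermite_window n x)"
    by (auto simp: hermite_function_eq K_def)
  have K: "K \<ge> 0" by (simp add: K_def)
  obtain C where C: "C \<ge> 0" "\<And>x. \<bar>hermite_window n x\<bar> \<le> C * exp (- \<bar>x\<bar>)"
    using hermite_decay[of n] by metis
  show ?thesis
  proof (rule not_frame_if_shifted_sums_vanish[where \<xi> = "a * of_int r" and C = "K * C" and c = c])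
    show "continuous_on UNIV (hermite_function n)"
      unfolding h by (intro continuous_intros)
    show "\<bar>hermite_function n x\<bar> \<le> K * C * exp (- \<bar>x\<bar>)" for x
    proof -
      have "\<bar>hermite_function n x\<bar> = K * \<bar>hermite_window n x\<bar>"
        unfolding h using K by (simp add: abs_mult)
      also have "\<dots> \<le> K * (C * exp (- \<bar>x\<bar>))" using K C(2)[of x] by (rule mult_left_mono[rotated])
      finally show ?thesis by simp
    qed
    show "((\<lambda>l. c l * hermite_function n (a * of_int r + of_int p * a * of_int (q * l - k))) has_sum 0) UNIV" for k
    proof -
      have eq: "a * of_int r + of_int p * a * of_int (q * l - k) = a * of_int (p * q * l + (r - p * k))" for l
        by (simp add: algebra_simps)
      have "((\<lambda>l. K * (c l * hermite_window n (a * of_int (p * q * l + (r - p * k))))) has_sum (K * lacunary_sum n c (p * q) a (r - p * k))) UNIV"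
        by (intro has_sum_cmult_right lacunary_sum_has_sum a c) (use p q in simp)
      thus ?thesis unfolding eq h zero by (simp only: mult.left_commute mult_zero_right)
    qed
  qed (use a p q c in auto)
qed

section \<open>Failure of the frame set conjecture\<close>

theorem mainTheorem1:
  fixes m :: nat
  assumes "m \<ge> 1"
  shows "frame_set (\<lambda>x. complex_of_real (hermite_function (4 * m) x)) \<noteq>
           {(\<alpha>, \<beta>). \<alpha> > 0 \<and> \<beta> > 0 \<and> \<alpha> * \<beta> < 1}
       \<and> frame_set (\<lambda>x. complex_of_real (hermite_function (4 * m + 1) x)) \<noteq>
           {(\<alpha>, \<beta>). \<alpha> > 0 \<and> \<beta> > 0 \<and> \<alpha> * \<beta> < 1 \<and>
              (\<forall>q::int. q \<ge> 2 \<longrightarrow> \<alpha> * \<beta> \<noteq> (real_of_int q - 1) / real_of_int q)}"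
proof (intro conjI)
  \<comment> \<open>density \<open>\<alpha> * \<beta> = 1 / 3\<close>\<close>
  obtain a where a: "a > 0" "\<And>s. odd s \<Longrightarrow> lacunary_sum (4 * m) alt_sign 6 a s = 0"
    using all_even_lacunary_sums_vanish[of "4 * m"] assms by auto
  have "\<not> L2_frame (gabor_system (\<lambda>x. complex_of_real (hermite_function (4 * m) x)) (2 * a) (1 / (2 * a * 3)))"
    using not_frame_if_lacunary_sums_vanish[of a 2 3 alt_sign "4 * m" 3] a alt_sign(1) by simp
  hence "(2 * a, 1 / (2 * a * 3)) \<notin> frame_set (\<lambda>x. complex_of_real (hermite_function (4 * m) x))"
    by (simp add: frame_set_def)
  moreover have "(2 * a, 1 / (2 * a * 3)) \<in> {(\<alpha>, \<beta>). \<alpha> > 0 \<and> \<beta> > 0 \<and> \<alpha> * \<beta> < 1}"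
    using a by simp
  ultimately show "frame_set (\<lambda>x. complex_of_real (hermite_function (4 * m) x)) \<noteq>
           {(\<alpha>, \<beta>). \<alpha> > 0 \<and> \<beta> > 0 \<and> \<alpha> * \<beta> < 1}" by metis
next
  \<comment> \<open>density \<open>\<alpha> * \<beta> = 1 / 4\<close>, which is below all exceptional values \<open>(q - 1) / q\<close>\<close>
  obtain a where a: "a > 0" "\<And>s. lacunary_sum (4 * m + 1) (\<lambda>_. 1) 4 a s = 0"
    using all_odd_lacunary_sums_vanish[of "4 * m + 1"] assms by auto
  have "\<not> L2_frame (gabor_system (\<lambda>x. complex_of_real (hermite_function (4 * m + 1) x)) a (1 / (a * 4)))"
    using not_frame_if_lacunary_sums_vanish[of a 1 4 "\<lambda>_. 1" "4 * m + 1" 0] a by simp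
  hence "(a, 1 / (a * 4)) \<notin> frame_set (\<lambda>x. complex_of_real (hermite_function (4 * m + 1) x))"
    by (simp add: frame_set_def)
  moreover have "(a, 1 / (a * 4)) \<in> {(\<alpha>, \<beta>). \<alpha> > 0 \<and> \<beta> > 0 \<and> \<alpha> * \<beta> < 1 \<and>
              (\<forall>q::int. q \<ge> 2 \<longrightarrow> \<alpha> * \<beta> \<noteq> (real_of_int q - 1) / real_of_int q)}"
  proof -
    have "1 / 4 \<noteq> (real_of_int q - 1) / real_of_int q" if "q \<ge> 2" for q
    proof -
      have "real_of_int q \<ge> 2" using that by simp
      thus ?thesis by (simp add: field_simps)
    qed
    thus ?thesis using a by simp
  qed
  ultimately show "frame_set (\<lambda>x. complex_of_real (hermite_function (4 * m + 1) x)) \<noteq>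
           {(\<alpha>, \<beta>). \<alpha> > 0 \<and> \<beta> > 0 \<and> \<alpha> * \<beta> < 1 \<and>
              (\<forall>q::int. q \<ge> 2 \<longrightarrow> \<alpha> * \<beta> \<noteq> (real_of_int q - 1) / real_of_int q)}" by metis
qed

end
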